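(* Let $d\ge 2$ and let $\gamma_d$ be the infimum of the set of all $\gamma\ge 0$ for which the equation $\exp(-\gamma(1-x)^d)=x$ has a solution $x<1$. Let $c<\gamma_d$ be fixed. Then in the probability space $Y_d(n,\frac{c}{n})$, $$\lim_{n\to\infty}\Pr\big[Y \text{ is } d\text{-collapsible} \;\big|\; Y\in\mathcal{F}_{n,d}\big]=1.$$
   Context: $\Delta_{n-1}$ denotes the $(n-1)$-dimensional simplex on vertex set $[n]$, $\Delta_{n-1}^{(i)}$ its $i$-skeleton and $\Delta_{n-1}(i)$ its set of $i$-dimensional faces. $Y_d(n,p)$ is the probability space of complexes $\Delta_{n-1}^{(d-1)}\subset Y\subset\Delta_{n-1}^{(d)}$ in which each $d$-simplex is included independently with probability $p$. A $(d-1)$-simplex $\tau$ is a free face of a complex $Y\subset\Delta_{n-1}^{(d)}$ if it is contained in exactly one $d$-simplex of $Y$. $R(Y)$ is the complex obtained from $Y$ by removing all free $(d-1)$-faces of $Y$ together with the $d$-simplices containing them; $R_0(Y)=Y$, $R_i(Y)=R(R_{i-1}(Y))$, and $R_\infty(Y)$ is the eventual stable complex. $Y$ is $d$-collapsible if $\dim R_\infty(Y)<d$. $\mathcal{F}_{n,d}$ is the family of all complexes $\Delta_{n-1}^{(d-1)}\subset Y\subset\Delta_{n-1}^{(d)}$ that do not contain the boundary of a $(d+1)$-simplex. *)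

theory Defs
  imports Complex_Main
begin

definition faces :: "nat \<Rightarrow> nat \<Rightarrow> nat set set" where
  "faces n k = {\<sigma>. \<sigma> \<subseteq> {1..n} \<and> card \<sigma> = k + 1}"

text \<open>A complex with full (d-1)-skeleton is determined by its set S of d-simplices.
A (d-1)-simplex tau is free if it lies in exactly one d-simplex of S.\<close>
definition free_face :: "nat set set \<Rightarrow> nat set \<Rightarrow> bool" where
  "free_face S \<tau> \<longleftrightarrow> card {\<sigma> \<in> S. \<tau> \<subseteq> \<sigma>} = 1"

text \<open>R(Y): remove all free (d-1)-faces together with the d-simplices containing them.
(Only the d-simplices are recorded; a removed (d-1)-face lies in no remaining
d-simplex, so it can never become free again.)\<close>
definition Rstep :: "nat \<Rightarrow> nat set set \<Rightarrow> nat set set" where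
  "Rstep d S = {\<sigma> \<in> S. \<not> (\<exists>\<tau>. \<tau> \<subseteq> \<sigma> \<and> card \<tau> = d \<and> free_face S \<tau>)}"

definition d_collapsible :: "nat \<Rightarrow> nat set set \<Rightarrow> bool" where
  "d_collapsible d S \<longleftrightarrow> (\<exists>i. (Rstep d ^^ i) S = {})"

definition in_F :: "nat \<Rightarrow> nat \<Rightarrow> nat set set \<Rightarrow> bool" where
  "in_F n d S \<longleftrightarrow> \<not> (\<exists>\<rho> \<in> faces n (d + 1). {\<sigma>. \<sigma> \<subseteq> \<rho> \<and> card \<sigma> = d + 1} \<subseteq> S)"

definition prob_Y :: "nat \<Rightarrow> nat \<Rightarrow> real \<Rightarrow> (nat set set \<Rightarrow> bool) \<Rightarrow> real" where
  "prob_Y n d p P = (\<Sum>S\<in>{S. S \<subseteq> faces n d \<and> P S}.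
      p ^ card S * (1 - p) ^ (card (faces n d) - card S))"

definition cond_prob_Y :: "nat \<Rightarrow> nat \<Rightarrow> real \<Rightarrow> (nat set set \<Rightarrow> bool) \<Rightarrow> (nat set set \<Rightarrow> bool) \<Rightarrow> real" where
  "cond_prob_Y n d p P Q = prob_Y n d p (\<lambda>S. P S \<and> Q S) / prob_Y n d p Q"

definition gamma_d :: "nat \<Rightarrow> real" where
  "gamma_d d = Inf {\<gamma>. \<gamma> \<ge> 0 \<and> (\<exists>x::real. x < 1 \<and> exp (- \<gamma> * (1 - x) ^ d) = x)}"

end

theory Submission
  imports Defs
begin

text \<open>If \<open>Y\<close> is not collapsible, the collapses stop at a nonempty core \<open>K\<close>: every \<open>(d-1)\<close>-face of a
simplex of \<open>K\<close> lies in at least two simplices of \<open>K\<close>. Call a set of \<open>d\<close>-simplices connected if it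
arises from one simplex by successively attaching simplices along \<open>(d-1)\<close>-faces, and let its excess
be the number of simplices minus the number of vertices. Excess does not decrease under attaching,
it starts at \<open>-d\<close>, and a core without the boundary of a \<open>(d+1)\<close>-simplex has excess at least 1. So
connected subsets of \<open>K\<close> can be enlarged until either (a) one of size \<open>O(ln n)\<close> and positive excess
occurs in \<open>Y\<close>, or (b) there is one of size \<open>L \<approx> \<epsilon> ln n\<close> and excess at most 0. Event (a) has
probability \<open>n\<^sup>-\<^sup>1 C\<^sup>L\<close> up to logarithms by a first-moment count. In case (b) there are at least
\<open>L - O(1)\<close> free faces, and at all but boundedly many of them \<open>K\<close> contains a witness tree of a fixed
depth \<open>k\<close>, these trees being pairwise disjoint. By the van den Berg--Kesten and Harris inequalities
the probability of a witness tree at a given face is at most about \<open>t\<^sub>k\<close>, where \<open>t\<^sub>0 = 1\<close> and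
\<open>t\<^sub>k\<^sub>+\<^sub>1 = 1 - exp (- c t\<^sub>k\<^sup>d)\<close>, so event (b) has probability at most \<open>n\<^sup>d (C t\<^sub>k)\<^sup>L\<close> up to constants. As
\<open>c < \<gamma>\<^sub>d\<close>, the sequence \<open>t\<^sub>k\<close> tends to 0, and both bounds vanish. Conditioning is harmless because
the Harris inequality bounds the probability of \<open>\<F>\<^sub>n\<^sub>,\<^sub>d\<close> away from 0.\<close>

subsection \<open>Harris and van den Berg--Kesten inequalities\<close>

text \<open>The weight of \<open>prob_Y\<close> over an arbitrary ground set, so that inequalities
  can be proved by induction on that set, one element at a time.\<close>

definition bern :: "'a set \<Rightarrow> real \<Rightarrow> ('a set \<Rightarrow> bool) \<Rightarrow> real" where
  "bern E p P = (\<Sum>S\<in>{S. S \<subseteq> E \<and> P S}. p ^ card S * (1 - p) ^ (card E - card S))"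

lemma bern_alt:
  assumes "finite E"
  shows "bern E p P = (\<Sum>S\<in>Pow E. if P S then p ^ card S * (1 - p) ^ (card E - card S) else 0)"
proof -
  have eq: "{S. S \<subseteq> E \<and> P S} = {S \<in> Pow E. P S}" by auto
  show ?thesis
    unfolding bern_def eq using assms by (intro sum.inter_filter) simp
qed

lemma bern_empty: "bern {} p P = (if P {} then 1 else 0)"
  by (simp add: bern_alt)

text \<open>Conditioning on the presence of \<open>e\<close>: the subsets of
  \<open>insert e E\<close> are those of \<open>E\<close> and their images under
  \<open>insert e\<close>.\<close>

lemma bern_insert:
  assumes "finite E" "e \<notin> E"
  shows "bern (insert e E) p P = p * bern E p (\<lambda>S. P (insert e S)) + (1 - p) * bern E p P"
proof -
  let ?w = "\<lambda>S. p ^ card S * (1 - p) ^ (card (insert e E) - card S)"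
  let ?g = "\<lambda>S. if P S then ?w S else 0"
  have inj: "inj_on (insert e) (Pow E)"
    using assms(2) by (auto simp: inj_on_def)
  have disj: "Pow E \<inter> insert e ` Pow E = {}" using assms(2) by auto
  have "bern (insert e E) p P = sum ?g (Pow E) + sum ?g (insert e ` Pow E)"
    using assms disj by (simp add: bern_alt Pow_insert sum.union_disjoint)
  moreover have "sum ?g (insert e ` Pow E) = p * bern E p (\<lambda>S. P (insert e S))"
    unfolding sum.reindex[OF inj] bern_alt[OF assms(1)] sum_distrib_left
  proof (rule sum.cong, simp)
    fix S assume "S \<in> Pow E"
    then have "e \<notin> S" "finite S" using assms by (auto intro: finite_subset)
    then show "(?g \<circ> insert e) S
      = p * (if P (insert e S) then p ^ card S * (1 - p) ^ (card E - card S) else 0)"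
      using assms by simp
  qed
  moreover have "sum ?g (Pow E) = (1 - p) * bern E p P"
    unfolding bern_alt[OF assms(1)] sum_distrib_left
  proof (rule sum.cong, simp)
    fix S assume "S \<in> Pow E"
    then have "card S \<le> card E" using assms(1) by (auto intro: card_mono)
    then show "?g S = (1 - p) * (if P S then p ^ card S * (1 - p) ^ (card E - card S) else 0)"
      using assms by (simp add: Suc_diff_le)
  qed
  ultimately show ?thesis by simp
qed

lemma bern_cong:
  assumes "\<And>S. S \<subseteq> E \<Longrightarrow> P S = Q S"
  shows "bern E p P = bern E p Q"
proof -
  have "{S. S \<subseteq> E \<and> P S} = {S. S \<subseteq> E \<and> Q S}" using assms by auto
  then show ?thesis by (simp add: bern_def)
qed

lemma bern_mono:
  assumes "finite E" "0 \<le> p" "p \<le> 1" "\<And>S. S \<subseteq> E \<Longrightarrow> P S \<Longrightarrow> Q S"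
  shows "bern E p P \<le> bern E p Q"
  unfolding bern_alt[OF assms(1)] using assms by (intro sum_mono) auto

lemma bern_nonneg: "0 \<le> p \<Longrightarrow> p \<le> 1 \<Longrightarrow> 0 \<le> bern E p P"
  unfolding bern_def by (intro sum_nonneg) auto

lemma bern_True: "finite E \<Longrightarrow> bern E p (\<lambda>_. True) = 1"
  by (induction E rule: finite_induct) (simp_all add: bern_empty bern_insert)

lemma bern_le_1: "finite E \<Longrightarrow> 0 \<le> p \<Longrightarrow> p \<le> 1 \<Longrightarrow> bern E p P \<le> 1"
  using bern_mono[of E p P "\<lambda>_. True"] by (simp add: bern_True)

lemma bern_disj:
  assumes "finite E"
  shows "bern E p (\<lambda>S. P S \<or> Q S) = bern E p P + bern E p Q - bern E p (\<lambda>S. P S \<and> Q S)"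
proof -
  have "bern E p (\<lambda>S. P S \<or> Q S) + bern E p (\<lambda>S. P S \<and> Q S) = bern E p P + bern E p Q"
    unfolding bern_alt[OF assms] by (simp only: sum.distrib[symmetric]) (rule sum.cong, auto)
  then show ?thesis by simp
qed

lemma bern_not:
  assumes "finite E"
  shows "bern E p (\<lambda>S. \<not> P S) = 1 - bern E p P"
proof -
  have "bern E p (\<lambda>S. P S \<or> \<not> P S) = bern E p P + bern E p (\<lambda>S. \<not> P S) - 0"
    unfolding bern_disj[OF assms] by (simp add: bern_def)
  then show ?thesis using bern_True[OF assms] by simp
qed

lemma bern_Bex_le:
  assumes "finite E" "0 \<le> p" "p \<le> 1" "finite I"
  shows "bern E p (\<lambda>S. \<exists>i\<in>I. P i S) \<le> (\<Sum>i\<in>I. bern E p (P i))"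
  using assms(4)
proof (induction I rule: finite_induct)
  case empty
  then show ?case by (simp add: bern_def)
next
  case (insert i I)
  have "bern E p (\<lambda>S. \<exists>j\<in>insert i I. P j S) = bern E p (\<lambda>S. P i S \<or> (\<exists>j\<in>I. P j S))"
    by simp
  also have "\<dots> \<le> bern E p (P i) + bern E p (\<lambda>S. \<exists>j\<in>I. P j S)"
    using bern_nonneg[OF assms(2,3)] by (simp add: bern_disj[OF assms(1)])
  finally show ?case using insert by simp
qed

section \<open>Increasing events and the Harris inequality\<close>

definition upset :: "('a set \<Rightarrow> bool) \<Rightarrow> bool" where
  "upset A \<longleftrightarrow> (\<forall>X Y. X \<subseteq> Y \<longrightarrow> A X \<longrightarrow> A Y)"

lemma upsetD: "upset A \<Longrightarrow> A X \<Longrightarrow> X \<subseteq> Y \<Longrightarrow> A Y"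
  by (auto simp: upset_def)

lemma upset_section: "upset A \<Longrightarrow> upset (\<lambda>S. A (insert e S))"
  unfolding upset_def by (meson insert_mono)

lemma bern_section_mono:
  assumes "finite E" "0 \<le> p" "p \<le> 1" "upset A"
  shows "bern E p A \<le> bern E p (\<lambda>S. A (insert e S))"
  by (rule bern_mono[OF assms(1-3)]) (rule upsetD[OF assms(4)], auto)

text \<open>Both events become likelier when \<open>e\<close> is present, so averaging over
  \<open>e\<close> gains \<open>p * (1 - p)\<close> times the product of the two increments.\<close>

lemma harris_upset:
  assumes "finite E" "0 \<le> p" "p \<le> 1" "upset A" "upset B"
  shows "bern E p A * bern E p B \<le> bern E p (\<lambda>S. A S \<and> B S)"
  using assms(1,4,5)
proof (induction E arbitrary: A B rule: finite_induct)
  case empty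
  then show ?case by (simp add: bern_empty)
next
  case (insert e E)
  let ?A1 = "\<lambda>S. A (insert e S)" and ?B1 = "\<lambda>S. B (insert e S)"
  have IH0: "bern E p A * bern E p B \<le> bern E p (\<lambda>S. A S \<and> B S)"
    using insert by blast
  have IH1: "bern E p ?A1 * bern E p ?B1 \<le> bern E p (\<lambda>S. ?A1 S \<and> ?B1 S)"
    by (intro insert.IH upset_section insert.prems)
  have a: "bern E p A \<le> bern E p ?A1" and b: "bern E p B \<le> bern E p ?B1"
    using insert assms(2,3) by (auto intro: bern_section_mono)
  have "0 \<le> p * (1 - p) * ((bern E p ?A1 - bern E p A) * (bern E p ?B1 - bern E p B))"
    using a b assms(2,3) by (intro mult_nonneg_nonneg) auto
  moreover have "p * (bern E p ?A1 * bern E p ?B1) \<le> p * bern E p (\<lambda>S. ?A1 S \<and> ?B1 S)"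
    using IH1 assms(2) by (rule mult_left_mono)
  moreover have "(1 - p) * (bern E p A * bern E p B) \<le> (1 - p) * bern E p (\<lambda>S. A S \<and> B S)"
    using IH0 assms(3) by (intro mult_left_mono) auto
  ultimately show ?case
    unfolding bern_insert[OF insert.hyps(1,2)] by (simp add: algebra_simps)
qed

text \<open>By inclusion-exclusion the complements deviate from independence by the same amount as
  the events themselves.\<close>

lemma harris_not_upset:
  assumes "finite E" "0 \<le> p" "p \<le> 1" "upset A" "upset B"
  shows "bern E p (\<lambda>S. \<not> A S) * bern E p (\<lambda>S. \<not> B S) \<le> bern E p (\<lambda>S. \<not> A S \<and> \<not> B S)"
proof -
  have "bern E p (\<lambda>S. \<not> A S \<and> \<not> B S) = 1 - bern E p (\<lambda>S. A S \<or> B S)"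
    using bern_not[OF assms(1), of p "\<lambda>S. A S \<or> B S"] by simp
  then show ?thesis
    using harris_upset[OF assms]
    by (simp add: bern_not[OF assms(1)] bern_disj[OF assms(1)] algebra_simps)
qed

text \<open>Applied to two families: the candidate apexes in \<open>bern_good_le\<close> and the
  boundaries of \<open>(d + 1)\<close>-simplices in \<open>bern_in_F_ge\<close>.\<close>

lemma harris_prod:
  assumes "finite E" "0 \<le> p" "p \<le> 1" "finite I" "\<And>i. i \<in> I \<Longrightarrow> upset (A i)"
  shows "(\<Prod>i\<in>I. 1 - bern E p (A i)) \<le> bern E p (\<lambda>S. \<not> (\<exists>i\<in>I. A i S))"
  using assms(4,5)
proof (induction I rule: finite_induct)
  case empty
  then show ?case by (simp add: bern_True[OF assms(1)])
next
  case (insert i I)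
  have up: "upset (\<lambda>S. \<exists>i\<in>I. A i S)"
    using insert.prems unfolding upset_def by (meson insertCI)
  have "(\<Prod>i\<in>insert i I. 1 - bern E p (A i)) = bern E p (\<lambda>S. \<not> A i S) * (\<Prod>i\<in>I. 1 - bern E p (A i))"
    using insert.hyps by (simp add: bern_not[OF assms(1)])
  also have "\<dots> \<le> bern E p (\<lambda>S. \<not> A i S) * bern E p (\<lambda>S. \<not> (\<exists>i\<in>I. A i S))"
    using insert by (intro mult_left_mono bern_nonneg assms) auto
  also have "\<dots> \<le> bern E p (\<lambda>S. \<not> A i S \<and> \<not> (\<exists>i\<in>I. A i S))"
    using insert.prems by (intro harris_not_upset[OF assms(1-3) _ up]) simp
  finally show ?case by simp
qed

text \<open>Disjoint occurrence. For increasing events a subset of \<open>S\<close> that itself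
  satisfies the event is a witness, so this agrees with the usual notion.\<close>

definition box :: "('a set \<Rightarrow> bool) \<Rightarrow> ('a set \<Rightarrow> bool) \<Rightarrow> 'a set \<Rightarrow> bool" where
  "box A B S \<longleftrightarrow> (\<exists>X Z. X \<inter> Z = {} \<and> X \<union> Z \<subseteq> S \<and> A X \<and> B Z)"

lemma boxI: "A X \<Longrightarrow> B Z \<Longrightarrow> X \<inter> Z = {} \<Longrightarrow> X \<union> Z \<subseteq> S \<Longrightarrow> box A B S"
  unfolding box_def by blast

lemma upset_box: "upset (box A B)"
  unfolding upset_def box_def by (meson order_trans)

text \<open>Disjoint witnesses cannot both use \<open>e\<close>, so \<open>e\<close> can be granted
  to one of them.\<close>

lemma box_insert:
  assumes "upset A" "upset B" "e \<notin> S"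
  shows "box A B (insert e S) \<longleftrightarrow> box (\<lambda>S. A (insert e S)) B S \<or> box A (\<lambda>S. B (insert e S)) S"
proof
  assume "box A B (insert e S)"
  then obtain X Z where XZ: "X \<inter> Z = {}" "X \<union> Z \<subseteq> insert e S" "A X" "B Z"
    unfolding box_def by blast
  show "box (\<lambda>S. A (insert e S)) B S \<or> box A (\<lambda>S. B (insert e S)) S"
  proof (cases "e \<in> Z")
    case True
    have "B (insert e (Z - {e}))" using XZ(4) True by (simp add: insert_absorb)
    then have "box A (\<lambda>S. B (insert e S)) S"
      using XZ True by (intro boxI[of A X _ "Z - {e}"]) auto
    then show ?thesis ..
  next
    case False
    \<comment> \<open>\<open>e\<close> may be missing from \<open>X\<close> as well; monotonicity
      lets it be added.\<close>
    have "A (insert e (X - {e}))" using XZ(3) by (rule upsetD[OF assms(1)]) auto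
    then have "box (\<lambda>S. A (insert e S)) B S"
      using XZ False by (intro boxI[of _ "X - {e}" B Z]) auto
    then show ?thesis ..
  qed
next
  assume "box (\<lambda>S. A (insert e S)) B S \<or> box A (\<lambda>S. B (insert e S)) S"
  then show "box A B (insert e S)"
  proof
    assume "box (\<lambda>S. A (insert e S)) B S"
    then obtain X Z where "X \<inter> Z = {}" "X \<union> Z \<subseteq> S" "A (insert e X)" "B Z"
      unfolding box_def by blast
    then show ?thesis using assms(3) by (intro boxI[of A "insert e X" B Z]) auto
  next
    assume "box A (\<lambda>S. B (insert e S)) S"
    then obtain X Z where "X \<inter> Z = {}" "X \<union> Z \<subseteq> S" "A X" "B (insert e Z)"
      unfolding box_def by blast
    then show ?thesis using assms(3) by (intro boxI[of A X B "insert e Z"]) auto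
  qed
qed

text \<open>The van den Berg--Kesten inequality. The restriction \<open>p \<le> 1/2\<close> lets a plain induction on the
ground set go through: the section of \<open>box A B\<close> at 1 is a union of two events which both contain
the section at 0, and the latter then enters with the coefficient \<open>1 - 2 * p\<close>.\<close>

lemma bern_box_le:
  assumes "finite E" "0 \<le> p" "p \<le> 1/2" "upset A" "upset B"
  shows "bern E p (box A B) \<le> bern E p A * bern E p B"
  using assms(1,4,5)
proof (induction E arbitrary: A B rule: finite_induct)
  case empty
  then show ?case by (auto simp: bern_empty box_def)
next
  case (insert e E)
  let ?A1 = "\<lambda>S. A (insert e S)" and ?B1 = "\<lambda>S. B (insert e S)"
  define a0 a1 b0 b1 where "a0 = bern E p A" and "a1 = bern E p ?A1"
    and "b0 = bern E p B" and "b1 = bern E p ?B1"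
  note up1 = insert.prems upset_section[OF insert.prems(1)] upset_section[OF insert.prems(2)]
  have p1: "p \<le> 1" using assms(3) by simp
  have ab: "a0 \<le> a1" "b0 \<le> b1"
    unfolding a0_def a1_def b0_def b1_def
    using insert assms(2) p1 by (auto intro: bern_section_mono)
  have sub: "box A B S \<Longrightarrow> box ?A1 B S \<and> box A ?B1 S" for S
    unfolding box_def using insert.prems by (meson upsetD subset_insertI)
  have "bern E p (\<lambda>S. box A B (insert e S)) = bern E p (\<lambda>S. box ?A1 B S \<or> box A ?B1 S)"
    using insert.hyps(2) by (intro bern_cong box_insert insert.prems) auto
  also have "\<dots> \<le> bern E p (box ?A1 B) + bern E p (box A ?B1) - bern E p (box A B)"
    unfolding bern_disj[OF insert.hyps(1)]
    using bern_mono[OF insert.hyps(1) assms(2) p1, of "box A B" "\<lambda>S. box ?A1 B S \<and> box A ?B1 S"] sub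
    by auto
  also have "\<dots> \<le> a1 * b0 + a0 * b1 - bern E p (box A B)"
    unfolding a0_def a1_def b0_def b1_def using insert.IH up1 by (auto intro!: add_mono)
  finally have 1: "p * bern E p (\<lambda>S. box A B (insert e S))
      \<le> p * (a1 * b0 + a0 * b1 - bern E p (box A B))"
    using assms(2) by (rule mult_left_mono)
  have "bern E p (box A B) \<le> a0 * b0"
    unfolding a0_def b0_def using insert.IH insert.prems by blast
  then have 2: "(1 - 2 * p) * bern E p (box A B) \<le> (1 - 2 * p) * (a0 * b0)"
    using assms(3) by (intro mult_left_mono) auto
  \<comment> \<open>Exactly the difference between the product of the two averages and the bound
    that follows from \<open>1\<close> and \<open>2\<close>.\<close>
  have 3: "0 \<le> p * p * ((a1 - a0) * (b1 - b0))"
    using ab by (intro mult_nonneg_nonneg assms(2)) auto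
  have "bern (insert e E) p (box A B) \<le> (1 - 2 * p) * (a0 * b0) + p * (a1 * b0 + a0 * b1)"
    unfolding bern_insert[OF insert.hyps(1,2)] using 1 2 by (simp add: algebra_simps)
  also have "\<dots> \<le> (p * a1 + (1 - p) * a0) * (p * b1 + (1 - p) * b0)"
    using 3 by (simp add: algebra_simps)
  finally show ?case
    unfolding bern_insert[OF insert.hyps(1,2)] a0_def a1_def b0_def b1_def .
qed

text \<open>Disjoint occurrence of a whole family, stated without choosing an order on the index set
  as an iterated \<open>box\<close> would.\<close>

definition bigbox :: "'i set \<Rightarrow> ('i \<Rightarrow> 'a set \<Rightarrow> bool) \<Rightarrow> 'a set \<Rightarrow> bool" where
  "bigbox I A S \<longleftrightarrow> (\<exists>W. (\<forall>i\<in>I. A i (W i) \<and> W i \<subseteq> S) \<and> (\<forall>i\<in>I. \<forall>j\<in>I. i \<noteq> j \<longrightarrow> W i \<inter> W j = {}))"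

lemma bigboxI:
  assumes "\<And>i. i \<in> I \<Longrightarrow> A i (W i)" "\<And>i. i \<in> I \<Longrightarrow> W i \<subseteq> S"
    and "\<And>i j. i \<in> I \<Longrightarrow> j \<in> I \<Longrightarrow> i \<noteq> j \<Longrightarrow> W i \<inter> W j = {}"
  shows "bigbox I A S"
  unfolding bigbox_def by (intro exI[of _ W] conjI ballI impI assms)

lemma upset_bigbox: "upset (bigbox I A)"
proof -
  have "bigbox I A Y" if XY: "X \<subseteq> Y" and bX: "bigbox I A X" for X Y
  proof -
    obtain W where "\<forall>i\<in>I. A i (W i) \<and> W i \<subseteq> X"
      "\<forall>i\<in>I. \<forall>j\<in>I. i \<noteq> j \<longrightarrow> W i \<inter> W j = {}"
      using bX unfolding bigbox_def by blast
    then show ?thesis using XY by (intro bigboxI[of I A W]) blast+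
  qed
  then show ?thesis unfolding upset_def by blast
qed

lemma bigbox_insert_imp_box:
  assumes "bigbox (insert i I) A S" "i \<notin> I"
  shows "box (A i) (bigbox I A) S"
proof -
  obtain W where W: "\<And>j. j \<in> insert i I \<Longrightarrow> A j (W j) \<and> W j \<subseteq> S"
    "\<And>j k. j \<in> insert i I \<Longrightarrow> k \<in> insert i I \<Longrightarrow> j \<noteq> k \<Longrightarrow> W j \<inter> W k = {}"
    using assms(1) unfolding bigbox_def by blast
  have "bigbox I A (\<Union>j\<in>I. W j)"
    using W by (intro bigboxI[of _ _ W]) auto
  moreover have "W i \<inter> W j = {}" if "j \<in> I" for j
    using W(2)[of i j] assms(2) that by auto
  ultimately show ?thesis
    using W(1) by (intro boxI[of "A i" "W i" _ "\<Union>j\<in>I. W j"]) auto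
qed

lemma bern_bigbox_le:
  assumes "finite E" "0 \<le> p" "p \<le> 1/2" "finite I" "\<And>i. i \<in> I \<Longrightarrow> upset (A i)"
    and "\<And>i. i \<in> I \<Longrightarrow> bern E p (A i) \<le> a"
  shows "bern E p (bigbox I A) \<le> a ^ card I"
  using assms(4-6)
proof (induction I rule: finite_induct)
  case empty
  then show ?case using bern_le_1[OF assms(1,2)] assms(3) by simp
next
  case (insert i I)
  have p1: "p \<le> 1" using assms(3) by simp
  have "bern E p (bigbox (insert i I) A) \<le> bern E p (box (A i) (bigbox I A))"
    using insert.hyps by (intro bern_mono[OF assms(1,2) p1] bigbox_insert_imp_box)
  also have "\<dots> \<le> bern E p (A i) * bern E p (bigbox I A)"
    using insert.prems by (intro bern_box_le[OF assms(1-3) _ upset_bigbox]) simp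
  also have "\<dots> \<le> a * a ^ card I"
  proof (rule mult_mono)
    show "bern E p (A i) \<le> a" using insert.prems by simp
    then show "0 \<le> a" using bern_nonneg[OF assms(2) p1, of E "A i"] by linarith
    show "bern E p (bigbox I A) \<le> a ^ card I" using insert by simp
  qed (rule bern_nonneg[OF assms(2) p1])
  finally show ?case using insert.hyps by simp
qed

lemma upset_superset: "upset (\<lambda>S. T \<subseteq> S)"
  unfolding upset_def by auto

lemma bern_superset:
  assumes "finite E" "T \<subseteq> E"
  shows "bern E p (\<lambda>S. T \<subseteq> S) = p ^ card T"
  using assms
proof (induction E arbitrary: T rule: finite_induct)
  case empty
  then show ?case by (simp add: bern_empty)
next
  case (insert e E)
  have T: "T - {e} \<subseteq> E" using insert.prems by auto
  then have fin: "finite (T - {e})" using insert.hyps(1) finite_subset by blast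
  have "bern E p (\<lambda>S. T \<subseteq> insert e S) = bern E p (\<lambda>S. T - {e} \<subseteq> S)"
    by (rule bern_cong) auto
  also have "\<dots> = p ^ card (T - {e})"
    by (rule insert.IH[OF T])
  finally have step: "bern (insert e E) p (\<lambda>S. T \<subseteq> S)
      = p * p ^ card (T - {e}) + (1 - p) * bern E p (\<lambda>S. T \<subseteq> S)"
    by (simp only: bern_insert[OF insert.hyps(1,2)])
  show ?case
  proof (cases "e \<in> T")
    case True
    have "\<not> T \<subseteq> S" if "S \<subseteq> E" for S
      using that True insert.hyps(2) by blast
    then have "bern E p (\<lambda>S. T \<subseteq> S) = bern E p (\<lambda>S. False)"
      by (intro bern_cong) simp
    moreover have "card T = Suc (card (T - {e}))"
      using fin by (intro card_Suc_Diff1[symmetric] True) simp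
    ultimately show ?thesis
      unfolding step by (simp add: bern_def)
  next
    case False
    then have "T \<subseteq> E" "T - {e} = T" using T by auto
    then show ?thesis
      unfolding step by (simp add: insert.IH algebra_simps)
  qed
qed

subsection \<open>Survival of a face\<close>

lemma finite_faces: "finite (faces n k)"
  unfolding faces_def by (rule finite_subset[of _ "Pow {1..n}"]) auto

lemma card_of_mem_faces: "\<sigma> \<in> faces n k \<Longrightarrow> card \<sigma> = k + 1"
  by (simp add: faces_def)

lemma finite_of_mem_faces: "\<sigma> \<in> faces n k \<Longrightarrow> finite \<sigma>"
  by (auto simp: faces_def intro: finite_subset)

text \<open>\<open>S\<close> contains a witness tree of depth \<open>k\<close> for the survival of the face \<open>f\<close>. Its branches use disjoint
sets of simplices, so that \<open>bern_box_le\<close> applies.\<close>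

primrec good :: "nat \<Rightarrow> nat \<Rightarrow> nat set \<Rightarrow> nat set set \<Rightarrow> bool" where
  "good n 0 f S = True"
| "good n (Suc k) f S = (\<exists>v\<in>{1..n} - f. box (\<lambda>X. {insert v f} \<subseteq> X)
     (bigbox f (\<lambda>y. good n k (insert v f - {y}))) S)"

lemma upset_Bex: "(\<And>i. i \<in> I \<Longrightarrow> upset (A i)) \<Longrightarrow> upset (\<lambda>S. \<exists>i\<in>I. A i S)"
  unfolding upset_def by meson

lemma upset_good: "upset (good n k f)"
proof (cases k)
  case 0
  have "good n 0 f = (\<lambda>S. True)" by (rule ext) simp
  then show ?thesis using 0 by (simp add: upset_def)
next
  case (Suc j)
  have "good n k f = (\<lambda>S. \<exists>v\<in>{1..n} - f. box (\<lambda>X. {insert v f} \<subseteq> X)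
     (bigbox f (\<lambda>y. good n j (insert v f - {y}))) S)"
    unfolding Suc by (rule ext) simp
  then show ?thesis by (simp add: upset_Bex upset_box del: insert_subset)
qed

text \<open>The value under ideal independence: one apex serves with probability
  \<open>p * t ^ d\<close>, for its simplex and \<open>d\<close> subtrees, and \<open>n\<close>
  apexes are available.\<close>

primrec surv :: "nat \<Rightarrow> nat \<Rightarrow> real \<Rightarrow> nat \<Rightarrow> real" where
  "surv n d p 0 = 1"
| "surv n d p (Suc k) = 1 - (1 - p * surv n d p k ^ d) ^ n"

lemma surv_bounds:
  assumes "0 \<le> p" "p \<le> 1"
  shows "0 \<le> surv n d p k" "surv n d p k \<le> 1"
proof -
  have "0 \<le> surv n d p k \<and> surv n d p k \<le> 1"
  proof (induction k)
    case (Suc k)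
    then have "0 \<le> surv n d p k ^ d" "surv n d p k ^ d \<le> 1"
      by (auto intro: power_le_one)
    then have "0 \<le> p * surv n d p k ^ d" "p * surv n d p k ^ d \<le> 1"
      using assms by (auto intro: mult_le_one)
    then show ?case by (auto intro: power_le_one)
  qed simp
  then show "0 \<le> surv n d p k" "surv n d p k \<le> 1" by auto
qed

lemma insert_mem_faces:
  assumes "f \<subseteq> {1..n}" "card f = d" "v \<in> {1..n} - f"
  shows "insert v f \<in> faces n d"
  using assms finite_subset[OF assms(1)] by (auto simp: faces_def)

lemma bern_box_superset_le:
  assumes "0 \<le> p" "p \<le> 1/2" "finite E" "T \<subseteq> E" "finite I"
    and "\<And>i. i \<in> I \<Longrightarrow> upset (A i)" "\<And>i. i \<in> I \<Longrightarrow> bern E p (A i) \<le> a"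
  shows "bern E p (box (\<lambda>X. T \<subseteq> X) (bigbox I A)) \<le> p ^ card T * a ^ card I"
proof -
  have "bern E p (box (\<lambda>X. T \<subseteq> X) (bigbox I A))
      \<le> bern E p (\<lambda>X. T \<subseteq> X) * bern E p (bigbox I A)"
    by (rule bern_box_le[OF assms(3,1,2) upset_superset upset_bigbox])
  also have "\<dots> \<le> p ^ card T * a ^ card I"
    unfolding bern_superset[OF assms(3,4)]
    using assms by (intro mult_left_mono bern_bigbox_le) auto
  finally show ?thesis .
qed

text \<open>At one apex the simplex and its subtrees occur disjointly, so the van den Berg--Kesten
  inequality bounds the probability by a product. Failures at different apexes are positively
  correlated, so Harris bounds the probability that all fail from below.\<close>

lemma bern_good_le:
  assumes p: "0 \<le> p" "p \<le> 1/2" and f: "f \<subseteq> {1..n}" "card f = d"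
  shows "bern (faces n d) p (good n k f) \<le> surv n d p k"
  using f
proof (induction k arbitrary: f)
  case 0
  then show ?case using bern_le_1[OF finite_faces p(1)] p(2) by simp
next
  case (Suc k)
  have p1: "p \<le> 1" using p by simp
  let ?a = "p * surv n d p k ^ d"
  define B where "B v = box (\<lambda>X. {insert v f} \<subseteq> X)
     (bigbox f (\<lambda>y. good n k (insert v f - {y})))" for v
  have finf: "finite f" using Suc.prems(1) by (rule finite_subset) simp
  have B_le: "bern (faces n d) p (B v) \<le> ?a" if v: "v \<in> {1..n} - f" for v
  proof -
    have "bern (faces n d) p (B v) \<le> p ^ card {insert v f} * surv n d p k ^ card f"
      unfolding B_def
    proof (rule bern_box_superset_le[OF p finite_faces _ finf upset_good])
      show "{insert v f} \<subseteq> faces n d"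
        using insert_mem_faces[OF Suc.prems v] by simp
      fix y assume "y \<in> f"
      then have "card (insert v f - {y}) = d"
        using v finf Suc.prems(2) by simp
      then show "bern (faces n d) p (good n k (insert v f - {y})) \<le> surv n d p k"
        using Suc.prems(1) v by (intro Suc.IH) auto
    qed
    then show ?thesis using Suc.prems(2) by simp
  qed
  have a01: "0 \<le> ?a" "?a \<le> 1"
    using surv_bounds[OF p(1) p1] p p1 by (auto intro!: mult_le_one power_le_one)
  \<comment> \<open>Only vertices outside \<open>f\<close> are candidates; replacing their number by
    \<open>n\<close> weakens the bound but makes it independent of \<open>f\<close>.\<close>
  have "(1 - ?a) ^ n \<le> (1 - ?a) ^ card ({1..n} - f)"
  proof (rule power_decreasing)
    show "card ({1..n} - f) \<le> n"
      using card_mono[of "{1..n}" "{1..n} - f"] by simp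
  qed (use a01 in auto)
  also have "\<dots> = (\<Prod>v\<in>{1..n} - f. 1 - ?a)" by simp
  also have "\<dots> \<le> (\<Prod>v\<in>{1..n} - f. 1 - bern (faces n d) p (B v))"
    using B_le a01 by (intro prod_mono) (auto simp: algebra_simps)
  also have "\<dots> \<le> bern (faces n d) p (\<lambda>S. \<not> (\<exists>v\<in>{1..n} - f. B v S))"
    by (rule harris_prod[OF finite_faces p(1) p1]) (auto simp: B_def upset_box)
  also have "\<dots> = 1 - bern (faces n d) p (\<lambda>S. \<exists>v\<in>{1..n} - f. B v S)"
    by (rule bern_not[OF finite_faces])
  also have "(\<lambda>S. \<exists>v\<in>{1..n} - f. B v S) = good n (Suc k) f"
    by (rule ext) (simp add: B_def)
  finally show ?case by simp
qed

subsection \<open>Connected sets of simplices and their excess\<close>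

text \<open>The apex \<open>v\<close> may be an old vertex and the attached simplex may already be
  present. The starting set is arbitrary so that stages of growth can be chained by
  \<open>ext_trans\<close>.\<close>

inductive ext :: "nat \<Rightarrow> 'a set set \<Rightarrow> 'a set set \<Rightarrow> bool" for d U where
  ext_refl: "ext d U U"
| ext_step: "ext d U T \<Longrightarrow> \<sigma> \<in> T \<Longrightarrow> \<tau> \<subseteq> \<sigma> \<Longrightarrow> card \<tau> = d \<Longrightarrow> v \<notin> \<tau> \<Longrightarrow> ext d U (insert (insert v \<tau>) T)"

lemma ext_subset: "ext d U T \<Longrightarrow> U \<subseteq> T"
  by (induction rule: ext.induct) auto

lemma ext_trans: "ext d T T' \<Longrightarrow> ext d U T \<Longrightarrow> ext d U T'"
  by (induction rule: ext.induct) (auto intro: ext_step)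

lemma ext_finite: "ext d U T \<Longrightarrow> finite U \<Longrightarrow> finite T"
  by (induction rule: ext.induct) auto

lemma ext_uniform:
  assumes "ext d U T" "\<forall>\<sigma>\<in>U. card \<sigma> = d + 1"
  shows "\<forall>\<sigma>\<in>T. card \<sigma> = d + 1"
  using assms
proof (induction rule: ext.induct)
  case (ext_step T \<sigma> \<tau> v)
  then have "card \<sigma> = d + 1" by blast
  \<comment> \<open>Infinite sets have cardinality 0, so a positive cardinality forces
    finiteness.\<close>
  then have "finite \<sigma>" by (metis add_is_0 card.infinite one_neq_zero)
  then have "finite \<tau>" using ext_step.hyps finite_subset by blast
  then show ?case using ext_step by auto
qed

definition excess :: "'a set set \<Rightarrow> int" where
  "excess T = int (card T) - int (card (\<Union>T))"

lemma uniform_finite: "\<forall>\<sigma>\<in>T. card \<sigma> = d + 1 \<Longrightarrow> \<sigma> \<in> T \<Longrightarrow> finite \<sigma>"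
  by (metis add_is_0 card.infinite one_neq_zero)

lemma uniform_finite_Union: "finite T \<Longrightarrow> \<forall>\<sigma>\<in>T. card \<sigma> = d + 1 \<Longrightarrow> finite (\<Union>T)"
  using uniform_finite by blast

text \<open>The vertices of \<open>\<tau>\<close> are already covered, so one simplex and at most
  the vertex \<open>v\<close> are added.\<close>

lemma excess_insert_new:
  assumes "finite T" "finite (\<Union>T)" "insert v \<tau> \<notin> T" "\<sigma> \<in> T" "\<tau> \<subseteq> \<sigma>"
  shows "excess (insert (insert v \<tau>) T) = excess T + (if v \<in> \<Union>T then 1 else 0)"
proof -
  have "\<Union>(insert (insert v \<tau>) T) = insert v (\<Union>T)" using assms(4,5) by blast
  then show ?thesis
    unfolding excess_def using assms by (simp add: card_insert_if)
qed

lemma ext_excess: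
  assumes "ext d U T" "finite U" "\<forall>\<sigma>\<in>U. card \<sigma> = d + 1"
  shows "excess U \<le> excess T"
  using assms
proof (induction rule: ext.induct)
  case (ext_step T \<sigma> \<tau> v)
  have fin: "finite T" by (rule ext_finite[OF ext_step.hyps(1) ext_step.prems(1)])
  have finU: "finite (\<Union>T)"
    by (rule uniform_finite_Union[OF fin ext_uniform[OF ext_step.hyps(1) ext_step.prems(2)]])
  show ?case
  proof (cases "insert v \<tau> \<in> T")
    case True
    then show ?thesis using ext_step by (simp add: insert_absorb)
  next
    case False
    then show ?thesis
      using excess_insert_new[OF fin finU False ext_step.hyps(2,3)] ext_step by simp
  qed
qed simp

lemma excess_single: "card \<sigma> = d + 1 \<Longrightarrow> excess {\<sigma>} = - int d"
  by (simp add: excess_def)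

lemma card_facets:
  assumes "card \<omega> = d + 1"
  shows "card {\<tau>. \<tau> \<subseteq> \<omega> \<and> card \<tau> = d} = d + 1" "finite {\<tau>. \<tau> \<subseteq> \<omega> \<and> card \<tau> = d}"
proof -
  have fin: "finite \<omega>" using assms by (metis add_is_0 card.infinite one_neq_zero)
  show "card {\<tau>. \<tau> \<subseteq> \<omega> \<and> card \<tau> = d} = d + 1"
    using n_subsets[OF fin, of d] assms by simp
  show "finite {\<tau>. \<tau> \<subseteq> \<omega> \<and> card \<tau> = d}"
    using fin by simp
qed

lemma superset_card_Suc:
  assumes "card \<omega> = d + 1" "f \<subseteq> \<omega>" "card f = d"
  obtains v where "v \<notin> f" "\<omega> = insert v f"
proof -
  have fin: "finite \<omega>" using assms by (metis add_is_0 card.infinite one_neq_zero)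
  then have "card (\<omega> - f) = 1"
    using assms by (simp add: card_Diff_subset finite_subset)
  then obtain v where v: "\<omega> - f = {v}" by (auto simp: card_1_singleton_iff)
  show ?thesis using v assms(2) by (intro that[of v]) auto
qed

text \<open>No face is free: this describes the sets at which collapsing stops.\<close>

definition core :: "nat \<Rightarrow> 'a set set \<Rightarrow> bool" where
  "core d K \<longleftrightarrow> (\<forall>\<sigma>\<in>K. \<forall>\<tau>. \<tau> \<subseteq> \<sigma> \<longrightarrow> card \<tau> = d \<longrightarrow> (\<exists>\<omega>\<in>K. \<omega> \<noteq> \<sigma> \<and> \<tau> \<subseteq> \<omega>))"

text \<open>Every vertex of a core lies in at least \<open>d + 1\<close> simplices, so double counting gives
\<open>excess T \<ge> 0\<close>. In the case of equality the neighbours of a simplex \<open>\<sigma>\<close> across its facets all have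
the same apex, and together with \<open>\<sigma>\<close> they form the boundary of a \<open>(d + 1)\<close>-simplex.\<close>

lemma core_excess:
  assumes d: "d \<ge> 2" and T: "finite T" "T \<noteq> {}" "\<forall>\<sigma>\<in>T. card \<sigma> = d + 1" "core d T"
    and nb: "\<And>\<rho>. \<rho> \<subseteq> \<Union>T \<Longrightarrow> card \<rho> = d + 2 \<Longrightarrow> \<not> {\<sigma>. \<sigma> \<subseteq> \<rho> \<and> card \<sigma> = d + 1} \<subseteq> T"
  shows "excess T \<ge> 1"
proof (rule ccontr)
  assume "\<not> 1 \<le> excess T"
  then have le: "card T \<le> card (\<Union>T)" unfolding excess_def by simp
  define st where "st u = {\<omega> \<in> T. u \<in> \<omega>}" for u
  have finV: "finite (\<Union>T)" by (rule uniform_finite_Union[OF T(1,3)])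
  have fin_st: "finite (st u)" for u unfolding st_def using T(1) by simp
  \<comment> \<open>\<open>w y\<close> is the apex of a neighbour of \<open>\<sigma>\<close> across
    the facet opposite to \<open>y\<close>.\<close>
  have nbr: "\<exists>w. \<forall>y\<in>\<sigma>. w y \<notin> \<sigma> \<and> insert (w y) (\<sigma> - {y}) \<in> T" if \<sigma>: "\<sigma> \<in> T" for \<sigma>
  proof (rule bchoice, rule ballI)
    fix y assume y: "y \<in> \<sigma>"
    have f: "finite \<sigma>" by (rule uniform_finite[OF T(3) \<sigma>])
    have c: "card (\<sigma> - {y}) = d" using y T(3) \<sigma> f by simp
    obtain \<omega> where \<omega>: "\<omega> \<in> T" "\<omega> \<noteq> \<sigma>" "\<sigma> - {y} \<subseteq> \<omega>"
      using T(4) \<sigma> c unfolding core_def by (metis Diff_subset)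
    obtain v where v: "v \<notin> \<sigma> - {y}" "\<omega> = insert v (\<sigma> - {y})"
      by (rule superset_card_Suc[OF _ \<omega>(3) c]) (use T(3) \<omega>(1) in auto)
    have "v \<notin> \<sigma>" using v \<omega>(2) y by blast
    then show "\<exists>w. w \<notin> \<sigma> \<and> insert w (\<sigma> - {y}) \<in> T" using v \<omega>(1) by blast
  qed
  \<comment> \<open>A vertex \<open>u\<close> of \<open>\<sigma>\<close> lies in
    \<open>\<sigma>\<close> and in its neighbours across the \<open>d\<close> facets containing
    \<open>u\<close>; these \<open>d + 1\<close> simplices are distinct.\<close>
  have star_sub: "insert \<sigma> ((\<lambda>y. insert (w y) (\<sigma> - {y})) ` (\<sigma> - {u})) \<subseteq> st u"
    and star_card: "card (insert \<sigma> ((\<lambda>y. insert (w y) (\<sigma> - {y})) ` (\<sigma> - {u}))) = d + 1"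
    if \<sigma>: "\<sigma> \<in> T" and w: "\<forall>y\<in>\<sigma>. w y \<notin> \<sigma> \<and> insert (w y) (\<sigma> - {y}) \<in> T" and u: "u \<in> \<sigma>" for \<sigma> w u
  proof -
    show "insert \<sigma> ((\<lambda>y. insert (w y) (\<sigma> - {y})) ` (\<sigma> - {u})) \<subseteq> st u"
      using \<sigma> w u unfolding st_def by auto
    have f: "finite \<sigma>" by (rule uniform_finite[OF T(3) \<sigma>])
    have inj: "inj_on (\<lambda>y. insert (w y) (\<sigma> - {y})) (\<sigma> - {u})"
    proof (rule inj_onI)
      fix y z assume yz: "y \<in> \<sigma> - {u}" "z \<in> \<sigma> - {u}"
        and eq: "insert (w y) (\<sigma> - {y}) = insert (w z) (\<sigma> - {z})"
      have "y \<notin> insert (w y) (\<sigma> - {y})" using w yz(1) by auto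
      then have "y \<notin> \<sigma> - {z}" unfolding eq by blast
      then show "y = z" using yz(1) by blast
    qed
    have "\<sigma> \<notin> (\<lambda>y. insert (w y) (\<sigma> - {y})) ` (\<sigma> - {u})" using w by auto
    then show "card (insert \<sigma> ((\<lambda>y. insert (w y) (\<sigma> - {y})) ` (\<sigma> - {u}))) = d + 1"
      using f inj u T(3) \<sigma> by (simp add: card_image)
  qed
  have deg: "card (st u) \<ge> d + 1" if u: "u \<in> \<Union>T" for u
  proof -
    obtain \<sigma> where \<sigma>: "\<sigma> \<in> T" "u \<in> \<sigma>" using u by blast
    obtain w where w: "\<forall>y\<in>\<sigma>. w y \<notin> \<sigma> \<and> insert (w y) (\<sigma> - {y}) \<in> T"
      using nbr[OF \<sigma>(1)] by blast
    show ?thesis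
      using card_mono[OF fin_st star_sub[OF \<sigma>(1) w \<sigma>(2)]] star_card[OF \<sigma>(1) w \<sigma>(2)] by simp
  qed
  \<comment> \<open>Double counting of incidences. Together with \<open>le\<close> and
    \<open>deg\<close> it forces every degree to be exactly \<open>d + 1\<close>, so the stars found
    above are complete.\<close>
  have "(\<Sum>u\<in>\<Union>T. card (st u)) = (\<Sum>u\<in>\<Union>T. \<Sum>\<omega>\<in>T. if u \<in> \<omega> then 1 else 0)"
    unfolding st_def using T(1) by (simp add: sum.inter_filter[symmetric])
  also have "\<dots> = (\<Sum>\<omega>\<in>T. \<Sum>u\<in>\<Union>T. if u \<in> \<omega> then 1 else 0)"
    by (rule sum.swap)
  also have "\<dots> = (\<Sum>\<omega>\<in>T. d + 1)"
  proof (rule sum.cong[OF refl])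
    fix \<omega> assume \<omega>: "\<omega> \<in> T"
    have "{u \<in> \<Union>T. u \<in> \<omega>} = \<omega>" using \<omega> by auto
    then show "(\<Sum>u\<in>\<Union>T. if u \<in> \<omega> then 1 else 0) = d + 1"
      using T(3) \<omega> finV by (simp add: sum.inter_filter[symmetric])
  qed
  finally have sum_eq: "(\<Sum>u\<in>\<Union>T. card (st u)) = card T * (d + 1)" by simp
  have deg_eq: "card (st u) = d + 1" if u: "u \<in> \<Union>T" for u
  proof (rule ccontr)
    assume "card (st u) \<noteq> d + 1"
    then have "d + 1 < card (st u)" using deg[OF u] by simp
    then have "(\<Sum>u\<in>\<Union>T. d + 1) < (\<Sum>u\<in>\<Union>T. card (st u))"
      using finV deg u by (intro sum_strict_mono_ex1) auto
    then have "card (\<Union>T) * (d + 1) < card T * (d + 1)" using sum_eq by simp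
    then show False using mult_le_mono1[OF le, of "d + 1"] by linarith
  qed
  obtain \<sigma> where \<sigma>: "\<sigma> \<in> T" using T(2) by blast
  have f: "finite \<sigma>" by (rule uniform_finite[OF T(3) \<sigma>])
  have c: "card \<sigma> = d + 1" using T(3) \<sigma> by blast
  obtain w where w: "\<forall>y\<in>\<sigma>. w y \<notin> \<sigma> \<and> insert (w y) (\<sigma> - {y}) \<in> T"
    using nbr[OF \<sigma>] by blast
  have star_eq: "st u = insert \<sigma> ((\<lambda>y. insert (w y) (\<sigma> - {y})) ` (\<sigma> - {u}))" if "u \<in> \<sigma>" for u
  proof (rule card_subset_eq[OF fin_st star_sub[OF \<sigma> w that], symmetric])
    have "u \<in> \<Union>T" using that \<sigma> by blast
    then show "card (insert \<sigma> ((\<lambda>y. insert (w y) (\<sigma> - {y})) ` (\<sigma> - {u}))) = card (st u)"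
      using star_card[OF \<sigma> w that] deg_eq by simp
  qed
  have w_const: "w y = w z" if y: "y \<in> \<sigma>" and z: "z \<in> \<sigma>" and yz: "y \<noteq> z" for y z
  proof -
    have "card (\<sigma> - {y, z}) = d - 1" using c y z yz f by (simp add: card_Diff_subset)
    \<comment> \<open>Here \<open>d \<ge> 2\<close> provides a third vertex \<open>u\<close> of
      \<open>\<sigma>\<close>.\<close>
    then have "card (\<sigma> - {y, z}) \<noteq> 0" using d by simp
    then have "\<sigma> - {y, z} \<noteq> {}" by (metis card.empty)
    then obtain u where u: "u \<in> \<sigma>" "u \<noteq> y" "u \<noteq> z" by blast
    let ?\<alpha> = "insert (w y) (\<sigma> - {y})"
    have \<alpha>: "?\<alpha> \<in> T" "w y \<notin> \<sigma>" using w y by auto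
    have "card (?\<alpha> - {z}) = d"
      using T(3) \<alpha>(1) z yz f by simp
    \<comment> \<open>Cross the facet of \<open>?\<alpha>\<close> that omits \<open>z\<close>. The
      simplex reached contains \<open>u\<close>, so it is in the known star of \<open>u\<close>.
      Only the neighbour of \<open>\<sigma>\<close> opposite to \<open>z\<close> fits, and it
      contains \<open>w y\<close> only if \<open>w y = w z\<close>.\<close>
    then obtain \<omega> where \<omega>: "\<omega> \<in> T" "\<omega> \<noteq> ?\<alpha>" "?\<alpha> - {z} \<subseteq> \<omega>"
      using T(4) \<alpha>(1) unfolding core_def by (metis Diff_subset)
    have wy: "w y \<in> \<omega>" using \<omega>(3) \<alpha>(2) z by blast
    have "\<omega> \<in> st u" using \<omega>(1,3) u unfolding st_def by blast
    then obtain x where x: "x \<in> \<sigma>" "x \<noteq> u" "\<omega> = insert (w x) (\<sigma> - {x})"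
      unfolding star_eq[OF u(1)] using wy \<alpha>(2) by blast
    have "x = z"
    proof (rule ccontr)
      assume "x \<noteq> z"
      moreover have "x \<noteq> y" using \<omega>(2) x(3) by blast
      ultimately have "x \<in> \<omega>" using \<omega>(3) x(1) by blast
      then show False using x w by auto
    qed
    then show "w y = w z" using wy x(3) \<alpha>(2) by auto
  qed
  obtain y0 where y0: "y0 \<in> \<sigma>" using c by fastforce
  define \<rho> where "\<rho> = insert (w y0) \<sigma>"
  have w0: "w y0 \<notin> \<sigma>" using w y0 by blast
  have wy: "w y = w y0" if "y \<in> \<sigma>" for y using w_const[OF that y0] by blast
  have "\<rho> \<subseteq> \<Union>T"
    unfolding \<rho>_def using \<sigma> w y0 by blast
  moreover have "card \<rho> = d + 2" unfolding \<rho>_def using w0 c f by simp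
  moreover have "{\<sigma>. \<sigma> \<subseteq> \<rho> \<and> card \<sigma> = d + 1} \<subseteq> T"
  proof
    fix \<alpha> assume "\<alpha> \<in> {\<sigma>. \<sigma> \<subseteq> \<rho> \<and> card \<sigma> = d + 1}"
    then have \<alpha>: "\<alpha> \<subseteq> \<rho>" "card \<alpha> = d + 1" by auto
    obtain y where y: "y \<notin> \<alpha>" "\<rho> = insert y \<alpha>"
      by (rule superset_card_Suc[OF _ \<alpha>]) (use \<open>card \<rho> = d + 2\<close> in auto)
    have \<alpha>_eq: "\<alpha> = insert (w y0) \<sigma> - {y}" using y unfolding \<rho>_def by simp
    show "\<alpha> \<in> T"
    proof (cases "y = w y0")
      case True
      then have "\<alpha> = \<sigma>" using \<alpha>_eq w0 by simp
      then show ?thesis using \<sigma> by simp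
    next
      case False
      then have "y \<in> \<sigma>" using y(2) unfolding \<rho>_def by blast
      moreover have "\<alpha> = insert (w y) (\<sigma> - {y})"
        unfolding wy[OF \<open>y \<in> \<sigma>\<close>] \<alpha>_eq using False by blast
      ultimately show ?thesis using w by simp
    qed
  qed
  ultimately show False using nb by blast
qed

section \<open>Free faces of a connected set\<close>

definition free_faces :: "nat \<Rightarrow> 'a set set \<Rightarrow> 'a set set" where
  "free_faces d T = {f. card f = d \<and> (\<exists>!\<sigma>. \<sigma> \<in> T \<and> f \<subseteq> \<sigma>)}"

lemma free_facesI:
  "card f = d \<Longrightarrow> \<sigma> \<in> T \<Longrightarrow> f \<subseteq> \<sigma> \<Longrightarrow> (\<And>\<omega>. \<omega> \<in> T \<Longrightarrow> f \<subseteq> \<omega> \<Longrightarrow> \<omega> = \<sigma>) \<Longrightarrow> f \<in> free_faces d T"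
  unfolding free_faces_def by blast

lemma free_facesE:
  assumes "f \<in> free_faces d T"
  obtains \<sigma> where "card f = d" "\<sigma> \<in> T" "f \<subseteq> \<sigma>" "\<forall>\<omega>\<in>T. f \<subseteq> \<omega> \<longrightarrow> \<omega> = \<sigma>"
  using assms unfolding free_faces_def by (elim CollectE conjE ex1E) blast

lemma free_faces_Union: "f \<in> free_faces d T \<Longrightarrow> f \<subseteq> \<Union>T"
  by (erule free_facesE) blast

lemma free_faces_subset: "free_faces d T \<subseteq> (\<Union>\<omega>\<in>T. {\<tau>. \<tau> \<subseteq> \<omega> \<and> card \<tau> = d})"
  unfolding free_faces_def by blast

lemma facets_UN_finite_card:
  assumes "finite T" "\<forall>\<sigma>\<in>T. card \<sigma> = d + 1"
  shows "finite (\<Union>\<omega>\<in>T. {\<tau>. \<tau> \<subseteq> \<omega> \<and> card \<tau> = d})"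
    and "card (\<Union>\<omega>\<in>T. {\<tau>. \<tau> \<subseteq> \<omega> \<and> card \<tau> = d}) \<le> (d + 1) * card T"
proof -
  show "finite (\<Union>\<omega>\<in>T. {\<tau>. \<tau> \<subseteq> \<omega> \<and> card \<tau> = d})"
    by (rule finite_UN_I[OF assms(1)], rule card_facets(2)) (use assms(2) in blast)
  have "card (\<Union>\<omega>\<in>T. {\<tau>. \<tau> \<subseteq> \<omega> \<and> card \<tau> = d}) \<le> (\<Sum>\<omega>\<in>T. card {\<tau>. \<tau> \<subseteq> \<omega> \<and> card \<tau> = d})"
    by (rule card_UN_le[OF assms(1)])
  also have "\<dots> = (\<Sum>\<omega>\<in>T. d + 1)"
    by (rule sum.cong[OF refl], rule card_facets(1)) (use assms(2) in blast)
  finally show "card (\<Union>\<omega>\<in>T. {\<tau>. \<tau> \<subseteq> \<omega> \<and> card \<tau> = d}) \<le> (d + 1) * card T"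
    by (simp add: mult.commute)
qed

lemma card_free_faces_le:
  assumes "finite T" "\<forall>\<sigma>\<in>T. card \<sigma> = d + 1"
  shows "finite (free_faces d T)" "card (free_faces d T) \<le> (d + 1) * card T"
proof -
  note F = facets_UN_finite_card[OF assms]
  show "finite (free_faces d T)"
    by (rule finite_subset[OF free_faces_subset F(1)])
  show "card (free_faces d T) \<le> (d + 1) * card T"
    using card_mono[OF F(1) free_faces_subset] F(2) by linarith
qed

text \<open>Attaching a simplex along a face changes the number of free faces by at least \<open>d - 1\<close> if its
apex is new and by at least \<open>- (d + 1)\<close> otherwise.\<close>

lemma card_free_faces_ge:
  assumes "ext d U T" "U = {\<sigma>}" "card \<sigma> = d + 1" "d \<ge> 1"
  shows "int (card (free_faces d T)) \<ge>
    (int d - 1) * (int (card (\<Union>T)) - int d - 1) - (int d + 1) * (excess T + int d)"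
  using assms
proof (induction rule: ext.induct)
  case ext_refl
  \<comment> \<open>Both products in the bound vanish for a single simplex.\<close>
  then have "card (\<Union>U) = d + 1" "excess U = - int d"
    by (auto simp: excess_single)
  then show ?case by simp
next
  case (ext_step T \<sigma>' \<tau> v)
  have u0: "\<forall>\<sigma>\<in>U. card \<sigma> = d + 1" "finite U" using ext_step.prems by auto
  have fin: "finite T" by (rule ext_finite[OF ext_step.hyps(1) u0(2)])
  have un: "\<forall>\<sigma>\<in>T. card \<sigma> = d + 1" by (rule ext_uniform[OF ext_step.hyps(1) u0(1)])
  have finU: "finite (\<Union>T)" by (rule uniform_finite_Union[OF fin un])
  let ?\<omega> = "insert v \<tau>"
  let ?T = "insert ?\<omega> T"
  have un': "\<forall>\<sigma>\<in>?T. card \<sigma> = d + 1"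
    by (rule ext_uniform[OF ext.ext_step[OF ext_step.hyps] u0(1)])
  note IH = ext_step.IH[OF ext_step.prems]
  note fF = card_free_faces_le(1)[OF fin un]
  have fF': "finite (free_faces d ?T)" using fin un' by (intro card_free_faces_le) auto
  show ?case
  proof (cases "?\<omega> \<in> T")
    case True
    then show ?thesis using IH by (simp add: insert_absorb)
  next
    case new: False
    note ex = excess_insert_new[OF fin finU new ext_step.hyps(2,3)]
    have Un: "\<Union>?T = insert v (\<Union>T)" using ext_step.hyps(2,3) by blast
    show ?thesis
    proof (cases "v \<in> \<Union>T")
      case True
      \<comment> \<open>Only facets of the attached simplex can cease to be free.\<close>
      let ?F = "{f. f \<subseteq> ?\<omega> \<and> card f = d}"
      have "card ?\<omega> = d + 1" using un' by blast
      note cF = card_facets[OF this]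
      have "free_faces d T - ?F \<subseteq> free_faces d ?T"
        unfolding free_faces_def by blast
      then have "card (free_faces d T - ?F) \<le> card (free_faces d ?T)"
        by (rule card_mono[OF fF'])
      then have "card (free_faces d T) \<le> card (free_faces d ?T) + (d + 1)"
        using diff_card_le_card_Diff[OF cF(2), of "free_faces d T"] cF(1) by linarith
      moreover have "card (\<Union>?T) = card (\<Union>T)" unfolding Un using True by (simp add: insert_absorb)
      moreover have "excess ?T = excess T + 1" using ex True by simp
      ultimately show ?thesis using IH by (simp add: algebra_simps)
    next
      case False
      have cv: "card (\<Union>?T) = card (\<Union>T) + 1" unfolding Un using False finU by simp
      have e: "excess ?T = excess T" using ex False by simp
      \<comment> \<open>The \<open>d\<close> facets through the new vertex \<open>v\<close> become
        free, and among the old free faces only \<open>\<tau>\<close> can be lost.\<close>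
      let ?N = "(\<lambda>y. ?\<omega> - {y}) ` \<tau>"
      have fin\<tau>: "finite \<tau>" using ext_step.hyps(4) ext_step.prems(3) card.infinite by fastforce
      have "inj_on (\<lambda>y. ?\<omega> - {y}) \<tau>" by (rule inj_onI) blast
      then have cN: "card ?N = d" using ext_step.hyps(4) by (simp add: card_image)
      have vN: "v \<in> f" if "f \<in> ?N" for f using that ext_step.hyps(5) by blast
      have N: "?N \<subseteq> free_faces d ?T"
      proof
        fix f assume f: "f \<in> ?N"
        then obtain y where "y \<in> \<tau>" "f = ?\<omega> - {y}" by blast
        then have "card f = d" "f \<subseteq> ?\<omega>" using ext_step.hyps(4,5) fin\<tau> by auto
        moreover have "\<omega> = ?\<omega>" if "\<omega> \<in> ?T" "f \<subseteq> \<omega>" for \<omega>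
          using that vN[OF f] False by blast
        ultimately show "f \<in> free_faces d ?T" by (intro free_facesI[of f d ?\<omega>]) simp_all
      qed
      have old: "free_faces d T - {\<tau>} \<subseteq> free_faces d ?T"
      proof
        fix f assume f0: "f \<in> free_faces d T - {\<tau>}"
        then have f1: "f \<in> free_faces d T" and ne: "f \<noteq> \<tau>" by auto
        obtain \<alpha> where f: "card f = d" "\<alpha> \<in> T" "f \<subseteq> \<alpha>"
          "\<forall>\<beta>\<in>T. f \<subseteq> \<beta> \<longrightarrow> \<beta> = \<alpha>" by (rule free_facesE[OF f1])
        have "\<not> f \<subseteq> ?\<omega>"
        proof
          assume "f \<subseteq> ?\<omega>"
          moreover have "v \<notin> f" using f(2,3) False by blast
          ultimately have "f \<subseteq> \<tau>" by blast
          then show False using card_subset_eq[OF fin\<tau>] f(1) ne ext_step.hyps(4) by simp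
        qed
        then show "f \<in> free_faces d ?T" using f by (intro free_facesI[of f d \<alpha>]) blast+
      qed
      have disj: "(free_faces d T - {\<tau>}) \<inter> ?N = {}"
        using free_faces_Union[of _ d T] False vN by blast
      have "card (free_faces d T - {\<tau>}) + card ?N = card ((free_faces d T - {\<tau>}) \<union> ?N)"
        using fF fin\<tau> disj by (intro card_Un_disjoint[symmetric]) auto
      also have "\<dots> \<le> card (free_faces d ?T)"
        using old N by (intro card_mono[OF fF']) auto
      finally have "card (free_faces d T - {\<tau>}) + d \<le> card (free_faces d ?T)" unfolding cN .
      moreover have "card (free_faces d T) - 1 \<le> card (free_faces d T - {\<tau>})"
        using diff_card_le_card_Diff[of "{\<tau>}" "free_faces d T"] by simp
      ultimately have "int (card (free_faces d T)) + int d - 1 \<le> int (card (free_faces d ?T))"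
        by linarith
      then show ?thesis using IH unfolding cv e by (simp add: algebra_simps)
    qed
  qed
qed

subsection \<open>Witness trees in a core\<close>

text \<open>A fixed choice of a simplex across \<open>f\<close>, so that the trees below are
  functions of \<open>K\<close>, \<open>\<sigma>\<close> and \<open>f\<close>. In a core such a
  simplex exists.\<close>

definition nxt :: "'a set set \<Rightarrow> 'a set \<Rightarrow> 'a set \<Rightarrow> 'a set" where
  "nxt K \<sigma> f = (SOME \<omega>. \<omega> \<in> K \<and> \<omega> \<noteq> \<sigma> \<and> f \<subseteq> \<omega>)"

primrec tree :: "'a set set \<Rightarrow> nat \<Rightarrow> 'a set \<Rightarrow> 'a set \<Rightarrow> 'a set set" where
  "tree K 0 \<sigma> f = {}"
| "tree K (Suc k) \<sigma> f = insert (nxt K \<sigma> f) (\<Union>y\<in>f. tree K k (nxt K \<sigma> f) (nxt K \<sigma> f - {y}))"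

primrec tsize :: "nat \<Rightarrow> nat \<Rightarrow> nat" where
  "tsize d 0 = 0"
| "tsize d (Suc k) = 1 + d * tsize d k"

lemma nxt_props:
  assumes "core d K" "\<forall>\<sigma>\<in>K. card \<sigma> = d + 1" "\<sigma> \<in> K" "f \<subseteq> \<sigma>" "card f = d"
  obtains v where "v \<notin> f" "nxt K \<sigma> f = insert v f" "nxt K \<sigma> f \<in> K" "nxt K \<sigma> f \<noteq> \<sigma>" "finite f"
proof -
  have "\<exists>\<omega>. \<omega> \<in> K \<and> \<omega> \<noteq> \<sigma> \<and> f \<subseteq> \<omega>" using assms unfolding core_def by blast
  then have *: "nxt K \<sigma> f \<in> K \<and> nxt K \<sigma> f \<noteq> \<sigma> \<and> f \<subseteq> nxt K \<sigma> f"
    unfolding nxt_def by (rule someI_ex)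
  then have "card (nxt K \<sigma> f) = d + 1" using assms(2) by blast
  moreover have "finite f"
    using uniform_finite[OF assms(2,3)] assms(4) by (rule finite_subset[rotated])
  ultimately show ?thesis using superset_card_Suc[of "nxt K \<sigma> f" d f] * assms(5) that by metis
qed

lemma tree_basic:
  assumes K: "core d K" "\<forall>\<sigma>\<in>K. card \<sigma> = d + 1"
  shows "\<sigma> \<in> K \<Longrightarrow> f \<subseteq> \<sigma> \<Longrightarrow> card f = d \<Longrightarrow>
    tree K k \<sigma> f \<subseteq> K \<and> finite (tree K k \<sigma> f) \<and> card (tree K k \<sigma> f) \<le> tsize d k"
proof (induction k arbitrary: \<sigma> f)
  case (Suc k)
  obtain v where v: "v \<notin> f" "nxt K \<sigma> f = insert v f" "nxt K \<sigma> f \<in> K" "finite f"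
    by (rule nxt_props[OF K Suc.prems])
  let ?\<omega> = "nxt K \<sigma> f"
  let ?t = "\<lambda>y. tree K k ?\<omega> (?\<omega> - {y})"
  have t: "?t y \<subseteq> K \<and> finite (?t y) \<and> card (?t y) \<le> tsize d k" if "y \<in> f" for y
    using v that Suc.prems(3) by (intro Suc.IH) auto
  have "card (\<Union>y\<in>f. ?t y) \<le> (\<Sum>y\<in>f. card (?t y))" by (rule card_UN_le[OF v(4)])
  also have "\<dots> \<le> d * tsize d k"
    using sum_bounded_above[of f "\<lambda>y. card (?t y)" "tsize d k"] t Suc.prems(3) by simp
  finally have c: "card (\<Union>y\<in>f. ?t y) \<le> d * tsize d k" .
  have fin: "finite (\<Union>y\<in>f. ?t y)" using v(4) t by blast
  have "card (tree K (Suc k) \<sigma> f) \<le> Suc (card (\<Union>y\<in>f. ?t y))"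
    unfolding tree.simps by (rule card_insert_le_m1[THEN order_trans, of "Suc (card (\<Union>y\<in>f. ?t y))"]) auto
  then show ?case using c fin t v(3) by auto
qed simp

text \<open>Each \<open>t j\<close> can be attached to any set containing \<open>\<omega>\<close>,
  in particular after the others.\<close>

lemma ext_UN:
  assumes "finite J" "\<And>j V. j \<in> J \<Longrightarrow> \<omega> \<in> V \<Longrightarrow> ext d V (V \<union> t j)" "\<omega> \<in> V"
  shows "ext d V (V \<union> (\<Union>j\<in>J. t j))"
  using assms
proof (induction J rule: finite_induct)
  case empty
  then show ?case by (simp add: ext_refl)
next
  case (insert j J)
  have 1: "ext d V (V \<union> (\<Union>j\<in>J. t j))" using insert by blast
  have "ext d (V \<union> (\<Union>j\<in>J. t j)) (V \<union> (\<Union>j\<in>J. t j) \<union> t j)"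
    using insert.prems by (intro insert.prems(1)) auto
  from ext_trans[OF this 1] show ?case by (simp add: Un_ac)
qed

lemma ext_tree:
  assumes K: "core d K" "\<forall>\<sigma>\<in>K. card \<sigma> = d + 1"
  shows "\<sigma> \<in> K \<Longrightarrow> f \<subseteq> \<sigma> \<Longrightarrow> card f = d \<Longrightarrow> \<sigma> \<in> U \<Longrightarrow> ext d U (U \<union> tree K k \<sigma> f)"
proof (induction k arbitrary: \<sigma> f U)
  case 0
  then show ?case by (simp add: ext_refl)
next
  case (Suc k)
  obtain v where v: "v \<notin> f" "nxt K \<sigma> f = insert v f" "nxt K \<sigma> f \<in> K" "finite f"
    by (rule nxt_props[OF K Suc.prems(1-3)])
  let ?\<omega> = "nxt K \<sigma> f"
  let ?t = "\<lambda>y. tree K k ?\<omega> (?\<omega> - {y})"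
  have 1: "ext d U (insert ?\<omega> U)"
    unfolding v(2) by (rule ext_step[OF ext_refl Suc.prems(4,2,3) v(1)])
  have "ext d (insert ?\<omega> U) (insert ?\<omega> U \<union> (\<Union>y\<in>f. ?t y))"
  proof (rule ext_UN[OF v(4)])
    fix y V assume "y \<in> f" "?\<omega> \<in> V"
    then show "ext d V (V \<union> ?t y)"
      using v Suc.prems(3) by (intro Suc.IH) auto
  qed simp
  from ext_trans[OF this 1] show ?case by (simp add: Un_ac)
qed

text \<open>Attaching simplices never decreases the excess, so the hypothesis on the excess keeps it constant
at every step of the growth, which means that every apex is new.\<close>

lemma tree_fresh:
  assumes K: "core d K" "\<forall>\<sigma>\<in>K. card \<sigma> = d + 1" and Kn: "\<Union>K \<subseteq> {1..n}"
  shows "\<sigma> \<in> U \<Longrightarrow> U \<subseteq> K \<Longrightarrow> finite U \<Longrightarrow> f \<subseteq> \<sigma> \<Longrightarrow> card f = d \<Longrightarrow>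
    \<forall>\<omega>\<in>U. f \<subseteq> \<omega> \<longrightarrow> \<omega> = \<sigma> \<Longrightarrow> excess (U \<union> tree K k \<sigma> f) \<le> excess U \<Longrightarrow>
    tree K k \<sigma> f \<inter> U = {} \<and> good n k f (tree K k \<sigma> f) \<and> \<Union>(tree K k \<sigma> f) \<inter> \<Union>U \<subseteq> f"
proof (induction k arbitrary: \<sigma> f U)
  case 0
  show ?case by simp
next
  case (Suc k)
  have \<sigma>K: "\<sigma> \<in> K" using Suc.prems(1,2) by blast
  obtain v where v: "v \<notin> f" "nxt K \<sigma> f = insert v f" "nxt K \<sigma> f \<in> K" "nxt K \<sigma> f \<noteq> \<sigma>" "finite f"
    by (rule nxt_props[OF K \<sigma>K Suc.prems(4,5)])
  define \<omega> where "\<omega> = nxt K \<sigma> f"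
  define t where "t y = tree K k \<omega> (\<omega> - {y})" for y
  define U1 where "U1 = insert \<omega> U"
  note \<omega> = v(2-4)[folded \<omega>_def]
  have tree_eq: "tree K (Suc k) \<sigma> f = insert \<omega> (\<Union>y\<in>f. t y)"
    by (simp add: \<omega>_def t_def)
  have \<omega>U: "\<omega> \<notin> U" using Suc.prems(6) \<omega>(1,3) by blast
  have fy: "\<omega> - {y} \<subseteq> \<omega>" "card (\<omega> - {y}) = d" if "y \<in> f" for y
    using that v(1,5) \<omega>(1) Suc.prems(5) by auto
  have U1: "U1 \<subseteq> K" "finite U1" "\<omega> \<in> U1" unfolding U1_def using Suc.prems(2,3) \<omega>(2) by auto
  have tK: "t y \<subseteq> K" "finite (t y)" if "y \<in> f" for y
    using tree_basic[OF K \<omega>(2) fy[OF that]] unfolding t_def by auto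
  have ext_t: "ext d V (V \<union> t y)" if "y \<in> f" "\<omega> \<in> V" for y V
    unfolding t_def using ext_tree[OF K \<omega>(2) fy[OF that(1)] that(2)] .
  have ext_tJ: "ext d V (V \<union> (\<Union>y\<in>J. t y))" if "J \<subseteq> f" "\<omega> \<in> V" for V J
    using that v(5) by (intro ext_UN[of _ \<omega>] ext_t) (auto intro: finite_subset)
  have unif: "\<forall>\<sigma>\<in>V. card \<sigma> = d + 1" if "V \<subseteq> K" for V using that K(2) by blast
  have ext1: "ext d U U1"
    unfolding U1_def \<omega>(1) by (rule ext_step[OF ext_refl Suc.prems(1,4,5) v(1)])
  have U1t: "U1 \<union> (\<Union>y\<in>f. t y) = U \<union> tree K (Suc k) \<sigma> f"
    unfolding tree_eq U1_def by auto
  have e1: "excess U \<le> excess U1"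
    by (rule ext_excess[OF ext1 Suc.prems(3) unif[OF Suc.prems(2)]])
  have e2: "excess U1 \<le> excess (U1 \<union> (\<Union>y\<in>f. t y))"
    by (rule ext_excess[OF ext_tJ U1(2) unif[OF U1(1)]]) (use U1 in auto)
  have e3: "excess (U1 \<union> (\<Union>y\<in>f. t y)) \<le> excess U" using Suc.prems(7) unfolding U1t .
  have vU: "v \<notin> \<Union>U"
  proof
    assume "v \<in> \<Union>U"
    then have "excess U1 = excess U + 1"
      unfolding U1_def \<omega>(1)
      using excess_insert_new[OF Suc.prems(3) _ _ Suc.prems(1,4), of v] \<omega>U \<omega>(1)
        uniform_finite_Union[OF Suc.prems(3) unif[OF Suc.prems(2)]] by simp
    then show False using e2 e3 by linarith
  qed
  \<comment> \<open>The branches are added one at a time. Applying the induction hypothesis for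
    depth \<open>k\<close> relative to \<open>U1\<close> and the branches already present makes them
    pairwise disjoint.\<close>
  have "J \<subseteq> f \<Longrightarrow> (\<forall>y\<in>J. t y \<inter> U1 = {} \<and> good n k (\<omega> - {y}) (t y) \<and> \<Union>(t y) \<inter> \<Union>U1 \<subseteq> \<omega> - {y})
      \<and> (\<forall>y\<in>J. \<forall>z\<in>J. y \<noteq> z \<longrightarrow> t y \<inter> t z = {})" if "finite J" for J
    using that
  proof (induction J rule: finite_induct)
    case empty
    then show ?case by simp
  next
    case (insert y J)
    then have IH: "\<forall>y\<in>J. t y \<inter> U1 = {} \<and> good n k (\<omega> - {y}) (t y) \<and> \<Union>(t y) \<inter> \<Union>U1 \<subseteq> \<omega> - {y}"
      "\<forall>y\<in>J. \<forall>z\<in>J. y \<noteq> z \<longrightarrow> t y \<inter> t z = {}" and J: "J \<subseteq> f" and y: "y \<in> f" by auto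
    let ?U2 = "U1 \<union> (\<Union>y\<in>J. t y)"
    have U2: "?U2 \<subseteq> K" "finite ?U2" "\<omega> \<in> ?U2"
      using U1 tK J insert.hyps(1) by blast+
    \<comment> \<open>The face \<open>\<omega> - {y}\<close> contains \<open>v\<close>, which no
      simplex of \<open>U\<close> does. It also contains the index \<open>z\<close> of every earlier
      branch, and the simplices of that branch avoid \<open>z\<close>.\<close>
    have uniq: "\<alpha> = \<omega>" if \<alpha>: "\<alpha> \<in> ?U2" "\<omega> - {y} \<subseteq> \<alpha>" for \<alpha>
    proof (rule ccontr)
      assume ne: "\<alpha> \<noteq> \<omega>"
      show False
      proof (cases "\<alpha> \<in> U")
        case True
        have "v \<in> \<alpha>" using \<alpha>(2) \<omega>(1) v(1) y by blast
        then show False using vU True by blast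
      next
        case False
        then obtain z where z: "z \<in> J" "\<alpha> \<in> t z" using \<alpha>(1) ne unfolding U1_def by blast
        have "z \<noteq> y" using z(1) insert.hyps(2) by blast
        then have "z \<in> \<alpha>" using \<alpha>(2) z(1) J \<omega>(1) by blast
        then have "z \<in> \<Union>(t z) \<inter> \<Union>U1" using z J \<omega>(1) U1(3) by blast
        then show False using IH(1) z(1) by blast
      qed
    qed
    \<comment> \<open>The remaining branches can be attached afterwards, so the excess after this
      one is squeezed between equal values.\<close>
    have "ext d (?U2 \<union> t y) ((?U2 \<union> t y) \<union> (\<Union>y\<in>f. t y))"
      using U2 by (intro ext_tJ) auto
    moreover have "(?U2 \<union> t y) \<union> (\<Union>y\<in>f. t y) = U1 \<union> (\<Union>y\<in>f. t y)" using J y by blast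
    ultimately have "ext d (?U2 \<union> t y) (U1 \<union> (\<Union>y\<in>f. t y))" by simp
    then have "excess (?U2 \<union> t y) \<le> excess (U1 \<union> (\<Union>y\<in>f. t y))"
      using U2 tK[OF y] by (intro ext_excess[OF _ _ unif]) auto
    moreover have "excess U1 \<le> excess ?U2"
      by (rule ext_excess[OF ext_tJ U1(2) unif[OF U1(1)]]) (use U1 J in auto)
    ultimately have ex: "excess (?U2 \<union> t y) \<le> excess ?U2" using e1 e3 by linarith
    have *: "t y \<inter> ?U2 = {} \<and> good n k (\<omega> - {y}) (t y) \<and> \<Union>(t y) \<inter> \<Union>?U2 \<subseteq> \<omega> - {y}"
      unfolding t_def[of y]
      by (rule Suc.IH[OF U2(3,1,2) fy[OF y] _ ex[unfolded t_def[of y]]]) (use uniq in blast)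
    have Uy: "\<Union>(t y) \<inter> \<Union>U1 \<subseteq> \<omega> - {y}" using * by blast
    have ty: "t y \<inter> U1 = {}" "good n k (\<omega> - {y}) (t y)" using * by blast+
    have dis: "t y \<inter> t z = {}" if "z \<in> J" for z using * that by blast
    have dis': "t z \<inter> t y = {}" if "z \<in> J" for z using dis[OF that] by blast
    show ?case
    proof (intro conjI ballI impI)
      fix a assume "a \<in> insert y J"
      then show "t a \<inter> U1 = {}" "good n k (\<omega> - {a}) (t a)" "\<Union>(t a) \<inter> \<Union>U1 \<subseteq> \<omega> - {a}"
        using IH(1) ty Uy by blast+
      fix b assume "b \<in> insert y J" "a \<noteq> b"
      then show "t a \<inter> t b = {}"
        using \<open>a \<in> insert y J\<close> IH(2) dis dis' by blast
    qed
  qed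
  from this[OF v(5) subset_refl]
  have A: "\<And>y. y \<in> f \<Longrightarrow> t y \<inter> U1 = {}" "\<And>y. y \<in> f \<Longrightarrow> good n k (\<omega> - {y}) (t y)"
    "\<And>y. y \<in> f \<Longrightarrow> \<Union>(t y) \<inter> \<Union>U1 \<subseteq> \<omega> - {y}"
    and D: "\<And>y z. y \<in> f \<Longrightarrow> z \<in> f \<Longrightarrow> y \<noteq> z \<Longrightarrow> t y \<inter> t z = {}" by blast+
  have "tree K (Suc k) \<sigma> f \<inter> U = {}"
    unfolding tree_eq using A(1) \<omega>U unfolding U1_def by blast
  moreover have "\<Union>(tree K (Suc k) \<sigma> f) \<inter> \<Union>U \<subseteq> f"
  proof
    fix x assume x: "x \<in> \<Union>(tree K (Suc k) \<sigma> f) \<inter> \<Union>U"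
    then have "x \<noteq> v" using vU by blast
    moreover have "x \<in> \<omega>"
    proof (cases "x \<in> \<omega>")
      case False
      then obtain y where "y \<in> f" "x \<in> \<Union>(t y)" using x unfolding tree_eq by blast
      then show ?thesis using A(3)[of y] x unfolding U1_def by blast
    qed simp
    ultimately show "x \<in> f" using \<omega>(1) by blast
  qed
  moreover have "good n (Suc k) f (tree K (Suc k) \<sigma> f)"
  proof -
    have "v \<in> {1..n} - f" using v(1) \<omega>(1,2) Kn by blast
    moreover have "bigbox f (\<lambda>y. good n k (insert v f - {y})) (\<Union>y\<in>f. t y)"
      unfolding \<omega>(1)[symmetric] by (rule bigboxI[of _ _ t]) (use A(2) D in auto)
    then have "box (\<lambda>X. {insert v f} \<subseteq> X) (bigbox f (\<lambda>y. good n k (insert v f - {y})))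
        (tree K (Suc k) \<sigma> f)"
      unfolding tree_eq
      by (rule boxI[of _ "{\<omega>}", rotated]) (use A(1) \<omega>(1) U1(3) in auto)
    ultimately show ?thesis unfolding good.simps by blast
  qed
  ultimately show ?case by blast
qed

text \<open>A set of size below \<open>N\<close> has excess at most 0, so by
  \<open>core_excess\<close> it is not a core and some face is free in it. The simplex of
  \<open>K\<close> across that face enlarges the set by exactly one, hence every size up to
  \<open>N\<close> is attained.\<close>

lemma core_connected_subset:
  assumes d: "d \<ge> 2" and K: "core d K" "\<forall>\<sigma>\<in>K. card \<sigma> = d + 1" "finite K" "\<sigma> \<in> K"
    and nb: "\<And>\<rho>. \<rho> \<subseteq> \<Union>K \<Longrightarrow> card \<rho> = d + 2 \<Longrightarrow> \<not> {\<sigma>. \<sigma> \<subseteq> \<rho> \<and> card \<sigma> = d + 1} \<subseteq> K"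
    and small: "\<And>U. ext d {\<sigma>} U \<Longrightarrow> U \<subseteq> K \<Longrightarrow> card U \<le> N \<Longrightarrow> excess U \<le> 0"
    and m: "1 \<le> m" "m \<le> N"
  shows "\<exists>T. ext d {\<sigma>} T \<and> T \<subseteq> K \<and> card T = m"
  using m
proof (induction m rule: dec_induct)
  case base
  show ?case using K(4) by (intro exI[of _ "{\<sigma>}"]) (simp add: ext_refl)
next
  case (step m)
  then obtain T where T: "ext d {\<sigma>} T" "T \<subseteq> K" "card T = m" by auto
  have finT: "finite T" using T(2) K(3) finite_subset by blast
  have unif: "\<forall>\<sigma>\<in>T. card \<sigma> = d + 1" using T(2) K(2) by blast
  have "\<not> core d T"
  proof
    assume "core d T"
    moreover have "T \<noteq> {}" using T(3) step.hyps by auto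
    moreover have "\<not> {\<sigma>. \<sigma> \<subseteq> \<rho> \<and> card \<sigma> = d + 1} \<subseteq> T" if "\<rho> \<subseteq> \<Union>T" "card \<rho> = d + 2" for \<rho>
      using nb[OF _ that(2)] that(1) T(2) by blast
    ultimately have "excess T \<ge> 1" using core_excess[OF d finT _ unif] by blast
    moreover have "excess T \<le> 0" using small[OF T(1,2)] T(3) step by simp
    ultimately show False by simp
  qed
  then obtain \<alpha> \<tau> where \<tau>: "\<alpha> \<in> T" "\<tau> \<subseteq> \<alpha>" "card \<tau> = d" "\<forall>\<omega>\<in>T. \<omega> \<noteq> \<alpha> \<longrightarrow> \<not> \<tau> \<subseteq> \<omega>"
    unfolding core_def by blast
  then obtain \<omega> where \<omega>: "\<omega> \<in> K" "\<omega> \<noteq> \<alpha>" "\<tau> \<subseteq> \<omega>"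
    using K(1) T(2) unfolding core_def by blast
  then have "\<omega> \<notin> T" using \<tau>(4) by blast
  obtain v where v: "v \<notin> \<tau>" "\<omega> = insert v \<tau>"
    by (rule superset_card_Suc[OF _ \<omega>(3) \<tau>(3)]) (use K(2) \<omega>(1) in auto)
  have "ext d {\<sigma>} (insert \<omega> T)"
    unfolding v(2) by (rule ext_step[OF T(1) \<tau>(1,2,3) v(1)])
  moreover have "card (insert \<omega> T) = Suc m" using finT \<open>\<omega> \<notin> T\<close> T(3) by simp
  ultimately show ?case using T(2) \<omega>(1) by blast
qed

text \<open>A set \<open>U\<close> is enlarged by pairs of witness trees as long as this increases the excess, which can
happen only boundedly often. Pairs are needed to make trees at different faces disjoint: the tree at
one face is fresh even relative to the union of \<open>U\<close> with the tree at another face.\<close>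

lemma core_imp_disjoint_trees:
  assumes K: "core d K" "\<forall>\<sigma>\<in>K. card \<sigma> = d + 1" "finite K" "\<sigma>0 \<in> K" and Kn: "\<Union>K \<subseteq> {1..n}"
    and T: "ext d {\<sigma>0} T" "T \<subseteq> K"
    and s: "s = tsize d k"
    and small: "\<And>U. ext d {\<sigma>0} U \<Longrightarrow> U \<subseteq> K \<Longrightarrow> card U \<le> card T + 2 * s * (d + 1) \<Longrightarrow> excess U \<le> 0"
  shows "\<exists>G \<subseteq> free_faces d T. card (free_faces d T) \<le> card G + (d + 1) * (2 * s * (d + 1)) \<and>
    box (\<lambda>X. T \<subseteq> X) (bigbox G (good n k)) K"
proof -
  have fin: "finite U" if "U \<subseteq> K" for U using that K(3) finite_subset by blast
  have unif: "\<forall>\<sigma>\<in>U. card \<sigma> = d + 1" if "U \<subseteq> K" for U using that K(2) by blast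
  define ow where "ow f = (THE \<sigma>. \<sigma> \<in> T \<and> f \<subseteq> \<sigma>)" for f
  have ow: "ow f \<in> T" "f \<subseteq> ow f" "card f = d" if "f \<in> free_faces d T" for f
    using that theI'[of "\<lambda>\<sigma>. \<sigma> \<in> T \<and> f \<subseteq> \<sigma>"] unfolding free_faces_def ow_def by auto
  have owK: "ow f \<in> K" if "f \<in> free_faces d T" for f using ow(1)[OF that] T(2) by blast
  define t where "t f = tree K k (ow f) f" for f
  have t: "t f \<subseteq> K" "card (t f) \<le> s" if "f \<in> free_faces d T" for f
    using tree_basic[OF K(1,2) owK[OF that] ow(2,3)[OF that]] unfolding t_def s by auto
  have ext_t: "ext d U (U \<union> t f)" if "f \<in> free_faces d T" "T \<subseteq> U" for f U
    unfolding t_def using ow[OF that(1)] that(2)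
    by (intro ext_tree[OF K(1,2) owK[OF that(1)]]) auto
  define good_U where "good_U U \<longleftrightarrow> ext d T U \<and> U \<subseteq> K \<and> card U \<le> card T + 2 * s * (d + 1)" for U
  have "\<exists>U. good_U U \<and> (\<forall>f\<in>free_faces d T. \<forall>g\<in>free_faces d T. excess (U \<union> t f \<union> t g) \<le> excess U)"
  proof (rule ccontr)
    assume "\<not> ?thesis"
    then have grow: "\<exists>f\<in>free_faces d T. \<exists>g\<in>free_faces d T. excess U < excess (U \<union> t f \<union> t g)"
      if "good_U U" for U
      using that by (meson not_le)
    \<comment> \<open>Each round adds two trees of at most \<open>s\<close> simplices and raises the
      excess by at least 1. It starts at \<open>- d\<close> or above, so \<open>d + 1\<close> rounds
      would contradict \<open>small\<close>.\<close>
    have "\<exists>U. ext d T U \<and> U \<subseteq> K \<and> card U \<le> card T + 2 * s * j \<and> excess U \<ge> int j - int d"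
      if "j \<le> d + 1" for j
      using that
    proof (induction j)
      case 0
      have "excess {\<sigma>0} \<le> excess T"
        using K(2,4) by (intro ext_excess[OF T(1)]) auto
      then have "- int d \<le> excess T" using excess_single K(2,4) by metis
      then show ?case using T(2) by (intro exI[of _ T]) (simp add: ext_refl)
    next
      case (Suc j)
      then obtain U where U: "ext d T U" "U \<subseteq> K" "card U \<le> card T + 2 * s * j"
        "excess U \<ge> int j - int d" by auto
      have "2 * s * j \<le> 2 * s * (d + 1)" using Suc.prems by (intro mult_le_mono2) simp
      then have "good_U U" unfolding good_U_def using U by simp
      then obtain f g where fg: "f \<in> free_faces d T" "g \<in> free_faces d T"
        "excess U < excess (U \<union> t f \<union> t g)" using grow by blast
      note TU = ext_subset[OF U(1)]
      have "ext d U (U \<union> t f)" using ext_t[OF fg(1) TU] .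
      moreover have "ext d (U \<union> t f) (U \<union> t f \<union> t g)" using TU by (intro ext_t[OF fg(2)]) auto
      ultimately have "ext d T (U \<union> t f \<union> t g)" using U(1) ext_trans by blast
      moreover have "card (U \<union> t f \<union> t g) \<le> card U + card (t f) + card (t g)"
        by (meson card_Un_le add_mono le_refl order_trans)
      then have "card (U \<union> t f \<union> t g) \<le> card T + 2 * s * Suc j"
        using U(3) t(2)[OF fg(1)] t(2)[OF fg(2)] by simp
      ultimately show ?case
        using U(2,4) t(1)[OF fg(1)] t(1)[OF fg(2)] fg(3)
        by (intro exI[of _ "U \<union> t f \<union> t g"]) auto
    qed
    from this[of "d + 1"] obtain U where U: "ext d T U" "U \<subseteq> K"
      "card U \<le> card T + 2 * s * (d + 1)" "excess U \<ge> 1" by auto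
    then show False using small[OF ext_trans[OF U(1) T(1)] U(2,3)] by simp
  qed
  then obtain U where U: "ext d T U" "U \<subseteq> K" "card U \<le> card T + 2 * s * (d + 1)"
    and stable: "\<And>f g. f \<in> free_faces d T \<Longrightarrow> g \<in> free_faces d T \<Longrightarrow> excess (U \<union> t f \<union> t g) \<le> excess U"
    unfolding good_U_def by blast
  note TU = ext_subset[OF U(1)]
  \<comment> \<open>The free faces of \<open>T\<close> that gain no further simplex in
    \<open>U\<close>. Every other one is a facet of one of the at most
    \<open>2 * s * (d + 1)\<close> simplices of \<open>U - T\<close>.\<close>
  define G where "G = {f \<in> free_faces d T. \<forall>\<omega>\<in>U. f \<subseteq> \<omega> \<longrightarrow> \<omega> = ow f}"
  have G: "f \<in> free_faces d T" "\<forall>\<omega>\<in>U. f \<subseteq> \<omega> \<longrightarrow> \<omega> = ow f" if "f \<in> G" for f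
    using that unfolding G_def by auto
  have finF: "finite (free_faces d T)" by (rule card_free_faces_le(1)[OF fin[OF T(2)] unif[OF T(2)]])
  have sub: "free_faces d T - G \<subseteq> (\<Union>\<omega>\<in>U - T. {\<tau>. \<tau> \<subseteq> \<omega> \<and> card \<tau> = d})"
  proof
    fix f assume "f \<in> free_faces d T - G"
    then have f: "f \<in> free_faces d T" and "f \<notin> G" by auto
    then obtain \<omega> where \<omega>: "\<omega> \<in> U" "f \<subseteq> \<omega>" "\<omega> \<noteq> ow f" unfolding G_def by blast
    obtain \<alpha> where "card f = d" "\<alpha> \<in> T" "f \<subseteq> \<alpha>" "\<forall>\<omega>\<in>T. f \<subseteq> \<omega> \<longrightarrow> \<omega> = \<alpha>"
      by (rule free_facesE[OF f])
    then have "\<omega> \<notin> T" using ow[OF f] \<omega>(2,3) by metis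
    then show "f \<in> (\<Union>\<omega>\<in>U - T. {\<tau>. \<tau> \<subseteq> \<omega> \<and> card \<tau> = d})"
      using \<omega> ow(3)[OF f] by blast
  qed
  have UT: "finite (U - T)" "\<forall>\<sigma>\<in>U - T. card \<sigma> = d + 1" using fin[OF U(2)] unif[OF U(2)] by auto
  note F = facets_UN_finite_card[OF UT]
  have "card (free_faces d T - G) \<le> (d + 1) * card (U - T)"
    using card_mono[OF F(1) sub] F(2) by linarith
  also have "\<dots> \<le> (d + 1) * (2 * s * (d + 1))"
    using U(3) card_Diff_subset[OF fin[OF T(2)] TU] by (intro mult_le_mono2) simp
  finally have "card (free_faces d T - G) \<le> (d + 1) * (2 * s * (d + 1))" .
  moreover have GF: "G \<subseteq> free_faces d T" unfolding G_def by blast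
  then have "card (free_faces d T - G) = card (free_faces d T) - card G"
    using finF finite_subset by (intro card_Diff_subset) auto
  ultimately have cG: "card (free_faces d T) \<le> card G + (d + 1) * (2 * s * (d + 1))" by linarith
  have fresh: "t f \<inter> U = {} \<and> good n k f (t f) \<and> \<Union>(t f) \<inter> \<Union>U \<subseteq> f" if f: "f \<in> G" for f
    unfolding t_def
  proof (rule tree_fresh[OF K(1,2) Kn _ U(2) fin[OF U(2)] ow(2,3)[OF G(1)[OF f]] G(2)[OF f]])
    show "ow f \<in> U" using ow(1)[OF G(1)[OF f]] TU by blast
    show "excess (U \<union> tree K k (ow f) f) \<le> excess U"
      \<comment> \<open>A single tree is the pair of two equal faces.\<close>
      using stable[OF G(1)[OF f] G(1)[OF f]] unfolding t_def by (simp add: Un_assoc)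
  qed
  have disj: "t f \<inter> t g = {}" if f: "f \<in> G" and g: "g \<in> G" and fg: "f \<noteq> g" for f g
  proof -
    note f' = G(1)[OF f] and g' = G(1)[OF g]
    have UfK: "U \<union> t f \<subseteq> K" using U(2) t(1)[OF f'] by blast
    \<comment> \<open>A simplex of \<open>t f\<close> containing \<open>g\<close> would force
      \<open>g \<subseteq> f\<close>, because \<open>t f\<close> and \<open>U\<close> share only
      vertices of \<open>f\<close>.\<close>
    have uniq: "\<forall>\<omega>\<in>U \<union> t f. g \<subseteq> \<omega> \<longrightarrow> \<omega> = ow g"
    proof (intro ballI impI)
      fix \<omega> assume \<omega>: "\<omega> \<in> U \<union> t f" "g \<subseteq> \<omega>"
      have "\<omega> \<notin> t f"
      proof
        assume "\<omega> \<in> t f"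
        then have "g \<subseteq> \<Union>(t f) \<inter> \<Union>U" using \<omega>(2) ow(1,2)[OF g'] TU by blast
        then have "g \<subseteq> f" using fresh[OF f] by blast
        moreover have "finite f"
          using ow(1,2)[OF f'] uniform_finite[OF unif[OF T(2)]] finite_subset by blast
        ultimately have "g = f" using ow(3)[OF f'] ow(3)[OF g'] by (intro card_subset_eq) auto
        then show False using fg by simp
      qed
      then show "\<omega> = ow g" using \<omega> G(2)[OF g] by blast
    qed
    have "excess U \<le> excess (U \<union> t f)"
      by (rule ext_excess[OF ext_t[OF f' TU] fin[OF U(2)] unif[OF U(2)]])
    then have "excess (U \<union> t f \<union> t g) \<le> excess (U \<union> t f)" using stable[OF f' g'] by linarith
    then have "t g \<inter> (U \<union> t f) = {}"
      unfolding t_def[of g]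
      using tree_fresh[OF K(1,2) Kn _ UfK fin[OF UfK] ow(2,3)[OF g'] uniq, of k] ow(1)[OF g'] TU
      by blast
    then show ?thesis by blast
  qed
  have "bigbox G (good n k) (\<Union>f\<in>G. t f)"
    by (rule bigboxI[of _ _ t]) (use fresh disj in blast)+
  then have "box (\<lambda>X. T \<subseteq> X) (bigbox G (good n k)) K"
  proof (rule boxI[of _ T, rotated])
    show "T \<inter> (\<Union>f\<in>G. t f) = {}" using fresh TU by blast
    show "T \<union> (\<Union>f\<in>G. t f) \<subseteq> K" using T(2) t(1) G(1) by blast
  qed simp
  then show ?thesis using GF cG by blast
qed

subsection \<open>Counting connected sets\<close>

text \<open>Facets are numbered by the position of the omitted vertex, so that one letter of a word
  can name a facet.\<close>

definition facet :: "nat set \<Rightarrow> nat \<Rightarrow> nat set" where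
  "facet \<sigma> i = \<sigma> - {sorted_list_of_set \<sigma> ! i}"

text \<open>The simplices visited by a depth-first walk, encoded by a word and a list of vertices, with the
stack of simplices from the current one back to the root. A letter \<open>i \<le> d\<close> attaches the next vertex
to the \<open>i\<close>-th facet of the current simplex and moves there, the letter \<open>d + 1\<close> moves back.\<close>

primrec visited :: "nat \<Rightarrow> nat list \<Rightarrow> nat list \<Rightarrow> nat set list \<Rightarrow> nat set set" where
  "visited d [] vs st = {}"
| "visited d (i # w) vs st = (if i \<le> d
     then (case vs of [] \<Rightarrow> {} | v # vs' \<Rightarrow>
        insert (insert v (facet (hd st) i)) (visited d w vs' (insert v (facet (hd st) i) # st)))
     else visited d w vs (tl st))"

text \<open>Insert the detour \<open>i\<close>, \<open>d + 1\<close> at the first moment when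
  \<open>\<sigma>\<close> is the current simplex, and \<open>v\<close> at the corresponding place of
  the list. The detour restores the stack, so the rest of the walk is unchanged.\<close>

lemma visited_attach:
  assumes "i \<le> d"
  shows "\<sigma> \<in> insert (hd st) (visited d w vs st) \<Longrightarrow> set w \<subseteq> {..d + 1} \<Longrightarrow>
    \<exists>w' vs'. length w' = length w + 2 \<and> set w' \<subseteq> {..d + 1} \<and> length vs' = length vs + 1 \<and>
      set vs' = insert v (set vs) \<and>
      visited d w' vs' st = insert (insert v (facet \<sigma> i)) (visited d w vs st)"
proof (induction w arbitrary: vs st)
  case Nil
  then show ?case using assms
    by - (rule exI[of _ "[i, d + 1]"], rule exI[of _ "v # vs"], auto)
next
  case (Cons j w)
  show ?case
  proof (cases "\<sigma> = hd st")
    case True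
    then show ?thesis using assms Cons.prems(2)
      by - (rule exI[of _ "i # (d + 1) # j # w"], rule exI[of _ "v # vs"], auto)
  next
    case ne: False
    show ?thesis
    proof (cases "j \<le> d")
      case True
      \<comment> \<open>With an empty list the walk would visit nothing, leaving only
        \<open>\<sigma> = hd st\<close>.\<close>
      then obtain u us where vs: "vs = u # us" using ne Cons.prems(1) by (cases vs) auto
      let ?\<alpha> = "insert u (facet (hd st) j)"
      have "\<sigma> \<in> insert (hd (?\<alpha> # st)) (visited d w us (?\<alpha> # st))"
        using ne Cons.prems(1) True vs by auto
      from Cons.IH[OF this] Cons.prems(2) obtain w' vs' where
        "length w' = length w + 2" "set w' \<subseteq> {..d + 1}" "length vs' = length us + 1"
        "set vs' = insert v (set us)"
        "visited d w' vs' (?\<alpha> # st) = insert (insert v (facet \<sigma> i)) (visited d w us (?\<alpha> # st))"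
        by auto
      then show ?thesis using True vs
        by - (rule exI[of _ "j # w'"], rule exI[of _ "u # vs'"], auto simp: insert_commute)
    next
      case False
      then have "\<sigma> \<in> insert (hd (tl st)) (visited d w vs (tl st))"
        using ne Cons.prems(1) by auto
      from Cons.IH[OF this] Cons.prems(2) obtain w' vs' where
        "length w' = length w + 2" "set w' \<subseteq> {..d + 1}" "length vs' = length vs + 1"
        "set vs' = insert v (set vs)"
        "visited d w' vs' (tl st) = insert (insert v (facet \<sigma> i)) (visited d w vs (tl st))"
        by auto
      then show ?thesis using False Cons.prems(2)
        by - (rule exI[of _ "j # w'"], rule exI[of _ "vs'"], auto)
    qed
  qed
qed

lemma obtain_facet:
  assumes "card \<sigma> = d + 1" "\<tau> \<subseteq> \<sigma>" "card \<tau> = d"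
  obtains i where "i \<le> d" "\<tau> = facet \<sigma> i"
proof -
  have fin: "finite \<sigma>" using assms(1) by (metis add_is_0 card.infinite one_neq_zero)
  obtain y where y: "y \<notin> \<tau>" "\<sigma> = insert y \<tau>" by (rule superset_card_Suc[OF assms])
  then have "y \<in> set (sorted_list_of_set \<sigma>)"
    unfolding set_sorted_list_of_set[OF fin] by blast
  then obtain i where i: "i < length (sorted_list_of_set \<sigma>)" "sorted_list_of_set \<sigma> ! i = y"
    by (auto simp: in_set_conv_nth)
  show ?thesis
    using i y assms(1) by (intro that[of i]) (auto simp: facet_def)
qed

text \<open>Each simplex after the first costs a letter to attach it, a letter to return and one
  vertex. Attaching a simplex already present is skipped, hence the exact lengths.\<close>

lemma ext_imp_visited:
  assumes "ext d U T" "U = {\<sigma>}" "card \<sigma> = d + 1"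
  shows "\<exists>w vs. length w = 2 * (card T - 1) \<and> set w \<subseteq> {..d + 1} \<and> length vs = card T - 1 \<and>
    set vs \<subseteq> \<Union>T \<and> T = insert \<sigma> (visited d w vs [\<sigma>])"
  using assms
proof (induction rule: ext.induct)
  case ext_refl
  then show ?case by simp
next
  case (ext_step T \<alpha> \<tau> v)
  have u0: "\<forall>\<sigma>\<in>U. card \<sigma> = d + 1" "finite U" using ext_step.prems by auto
  have fin: "finite T" by (rule ext_finite[OF ext_step.hyps(1) u0(2)])
  have un: "\<forall>\<sigma>\<in>T. card \<sigma> = d + 1" by (rule ext_uniform[OF ext_step.hyps(1) u0(1)])
  obtain w vs where w: "length w = 2 * (card T - 1)" "set w \<subseteq> {..d + 1}" "length vs = card T - 1"
    "set vs \<subseteq> \<Union>T" "T = insert \<sigma> (visited d w vs [\<sigma>])"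
    using ext_step.IH[OF ext_step.prems] by blast
  show ?case
  proof (cases "insert v \<tau> \<in> T")
    case True
    then have eq: "insert (insert v \<tau>) T = T" by blast
    show ?thesis unfolding eq by (rule ext_step.IH[OF ext_step.prems])
  next
    case False
    have c: "card (insert (insert v \<tau>) T) = card T + 1" using fin False by simp
    have pos: "card T > 0" using fin ext_step.hyps(2) by (auto simp: card_gt_0_iff)
    obtain i where i: "i \<le> d" "\<tau> = facet \<alpha> i"
      by (rule obtain_facet[OF _ ext_step.hyps(3,4)]) (use un ext_step.hyps(2) in auto)
    have "\<alpha> \<in> insert (hd [\<sigma>]) (visited d w vs [\<sigma>])" using w(5) ext_step.hyps(2) by simp
    from visited_attach[OF i(1) this w(2), of v] obtain w' vs' where
      w': "length w' = length w + 2" "set w' \<subseteq> {..d + 1}" "length vs' = length vs + 1"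
      "set vs' = insert v (set vs)"
      "visited d w' vs' [\<sigma>] = insert (insert v \<tau>) (visited d w vs [\<sigma>])"
      unfolding i(2) by blast
    show ?thesis
    proof (rule exI[of _ w'], rule exI[of _ vs'], intro conjI)
      show "length w' = 2 * (card (insert (insert v \<tau>) T) - 1)" using w'(1) w(1) c pos by simp
      show "length vs' = card (insert (insert v \<tau>) T) - 1" using w'(3) w(3) c pos by simp
      show "set vs' \<subseteq> \<Union>(insert (insert v \<tau>) T)" using w'(4) w(4) by auto
      show "insert (insert v \<tau>) T = insert \<sigma> (visited d w' vs' [\<sigma>])"
        unfolding w'(5) by (subst w(5)) (rule insert_commute)
    qed (rule w'(2))
  qed
qed

text \<open>For finite \<open>A\<close>, at least \<open>x\<close> of the \<open>r\<close> entries
  repeat an element of \<open>A\<close> or an earlier entry. The additive form avoids truncated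
  subtraction.\<close>

definition repeating :: "nat \<Rightarrow> nat \<Rightarrow> nat \<Rightarrow> nat set \<Rightarrow> nat list set" where
  "repeating n r x A =
    {vs. set vs \<subseteq> {1..n} \<and> length vs = r \<and> card (A \<union> set vs) + x \<le> card A + r}"

lemma finite_repeating: "finite (repeating n r x A)"
  by (rule finite_subset[OF _ finite_lists_length_eq[of "{1..n}" r]]) (auto simp: repeating_def)

text \<open>Split by the first entry. A new one has at most \<open>n\<close> choices and joins
  \<open>A\<close>, keeping \<open>card A + r\<close> fixed; one from \<open>A\<close> has
  \<open>card A\<close> choices in place of a factor \<open>n\<close>. The factor
  \<open>2 ^ r\<close> pays for the two cases.\<close>

lemma card_repeating:
  "finite A \<Longrightarrow> card (repeating n r x A) * n ^ x \<le> 2 ^ r * n ^ r * (card A + r) ^ x"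
proof (induction r arbitrary: x A)
  case 0
  show ?case
  proof (cases x)
    case 0
    have "repeating n 0 x A \<subseteq> {[]}" by (auto simp: repeating_def)
    then have "card (repeating n 0 x A) \<le> 1" using card_mono[of "{[]}" "repeating n 0 x A"] by simp
    then show ?thesis using 0 by simp
  next
    case (Suc x')
    then have "repeating n 0 x A = {}" by (auto simp: repeating_def)
    then show ?thesis by simp
  qed
next
  case (Suc r)
  show ?case
  proof (cases x)
    case 0
    have "card (repeating n (Suc r) x A) \<le> card {vs. set vs \<subseteq> {1..n} \<and> length vs = Suc r}"
      by (rule card_mono[OF finite_lists_length_eq]) (auto simp: repeating_def)
    also have "\<dots> = n ^ Suc r" using card_lists_length_eq[of "{1..n}" "Suc r"] by simp
    also have "\<dots> \<le> 2 ^ Suc r * n ^ Suc r" by simp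
    finally show ?thesis using 0 by simp
  next
    case (Suc x')
    let ?a = "card A"
    let ?N = "\<Union>v\<in>{1..n} - A. (#) v ` repeating n r x (insert v A)"
    let ?O = "\<Union>v\<in>A. (#) v ` repeating n r x' A"
    have sub: "repeating n (Suc r) x A \<subseteq> ?N \<union> ?O"
    proof
      fix vs assume vs: "vs \<in> repeating n (Suc r) x A"
      then obtain v us where vu: "vs = v # us" by (cases vs) (auto simp: repeating_def)
      show "vs \<in> ?N \<union> ?O"
      proof (cases "v \<in> A")
        case True
        then have "A \<union> set vs = A \<union> set us" using vu by auto
        then have "us \<in> repeating n r x' A" using vs vu Suc by (auto simp: repeating_def)
        then show ?thesis using True vu by blast
      next
        case False
        have "A \<union> set vs = insert v A \<union> set us" using vu by auto
        then have "us \<in> repeating n r x (insert v A)"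
          using vs vu False \<open>finite A\<close> by (auto simp: repeating_def)
        moreover have "v \<in> {1..n}" using vs vu by (auto simp: repeating_def)
        ultimately show ?thesis using False vu by blast
      qed
    qed
    have cimg: "card ((#) v ` R) = card R" for v :: nat and R by (rule card_image) simp
    have "card (repeating n (Suc r) x A) \<le> card ?N + card ?O"
      using card_mono[OF _ sub] card_Un_le[of ?N ?O] finite_repeating \<open>finite A\<close> by fastforce
    also have "card ?N \<le> (\<Sum>v\<in>{1..n} - A. card (repeating n r x (insert v A)))"
      using card_UN_le[of "{1..n} - A" "\<lambda>v. (#) v ` repeating n r x (insert v A)"] cimg by simp
    also have "card ?O \<le> (\<Sum>v\<in>A. card (repeating n r x' A))"
      using card_UN_le[of A "\<lambda>v. (#) v ` repeating n r x' A"] cimg \<open>finite A\<close> by simp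
    finally have "card (repeating n (Suc r) x A) * n ^ x
      \<le> ((\<Sum>v\<in>{1..n} - A. card (repeating n r x (insert v A)))
        + (\<Sum>v\<in>A. card (repeating n r x' A))) * n ^ x" by (simp add: mult_le_mono1)
    also have "\<dots> = (\<Sum>v\<in>{1..n} - A. card (repeating n r x (insert v A)) * n ^ x)
        + ?a * (card (repeating n r x' A) * n ^ x' * n)"
      unfolding distrib_right sum_distrib_right by (simp add: Suc mult_ac)
    also have "(\<Sum>v\<in>{1..n} - A. card (repeating n r x (insert v A)) * n ^ x)
        \<le> (\<Sum>v\<in>{1..n} - A. 2 ^ r * n ^ r * (?a + Suc r) ^ x)"
    proof (rule sum_mono)
      fix v assume "v \<in> {1..n} - A"
      then have "card (insert v A) + r = ?a + Suc r" using \<open>finite A\<close> by simp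
      then show "card (repeating n r x (insert v A)) * n ^ x \<le> 2 ^ r * n ^ r * (?a + Suc r) ^ x"
        using Suc.IH[of "insert v A" x] \<open>finite A\<close> by simp
    qed
    also have "\<dots> \<le> n * (2 ^ r * n ^ r * (?a + Suc r) ^ x)"
      using card_mono[of "{1..n}" "{1..n} - A"] by simp
    also have "?a * (card (repeating n r x' A) * n ^ x' * n)
        \<le> (?a + Suc r) * (2 ^ r * n ^ r * (?a + Suc r) ^ x' * n)"
    proof -
      have "card (repeating n r x' A) * n ^ x' \<le> 2 ^ r * n ^ r * (?a + r) ^ x'"
        by (rule Suc.IH[OF \<open>finite A\<close>])
      also have "\<dots> \<le> 2 ^ r * n ^ r * (?a + Suc r) ^ x'"
        by (intro mult_le_mono2 power_mono) auto
      finally show ?thesis by (rule mult_le_mono[OF le_add1 mult_le_mono1])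
    qed
    finally show ?thesis using Suc by (simp add: algebra_simps)
  qed
qed

definition connected_sets :: "nat \<Rightarrow> nat \<Rightarrow> nat \<Rightarrow> nat set set set" where
  "connected_sets n d m =
    {T. (\<exists>\<sigma>\<in>faces n d. ext d {\<sigma>} T) \<and> T \<subseteq> faces n d \<and> card T = m}"

lemma finite_connected_sets: "finite (connected_sets n d m)"
  by (rule finite_subset[of _ "Pow (faces n d)"]) (auto simp: connected_sets_def finite_faces)

lemma card_faces_le: "card (faces n d) \<le> n ^ (d + 1)"
proof -
  have "card (faces n d) = n choose (d + 1)"
    unfolding faces_def using n_subsets[of "{1..n}" "d + 1"] by simp
  also have "\<dots> \<le> n ^ (d + 1)"
    using binomial_le_pow[of "d + 1" n] binomial_eq_0[of n "d + 1"]
    by (cases "n < d + 1") (simp_all only: not_less le0)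
  finally show ?thesis .
qed

definition walk_words :: "nat \<Rightarrow> nat \<Rightarrow> nat list set" where
  "walk_words d m = {w. set w \<subseteq> {..d + 1} \<and> length w = 2 * (m - 1)}"

lemma walk_words: "finite (walk_words d m)" "card (walk_words d m) = (d + 2) ^ (2 * (m - 1))"
  unfolding walk_words_def
  using finite_lists_length_eq[of "{..d + 1}"] card_lists_length_eq[of "{..d + 1}"] by simp_all

lemma connected_set_visited:
  assumes "T \<in> connected_sets n d m"
  obtains \<sigma> w vs where "\<sigma> \<in> faces n d" "w \<in> walk_words d m" "set vs \<subseteq> {1..n}" "length vs = m - 1"
    "\<sigma> \<union> set vs \<subseteq> \<Union>T" "T = insert \<sigma> (visited d w vs [\<sigma>])"
proof -
  obtain \<sigma> where \<sigma>: "\<sigma> \<in> faces n d" "ext d {\<sigma>} T" and T: "T \<subseteq> faces n d" "card T = m"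
    using assms unfolding connected_sets_def by blast
  obtain w vs where w: "length w = 2 * (card T - 1)" "set w \<subseteq> {..d + 1}" "length vs = card T - 1"
    "set vs \<subseteq> \<Union>T" "T = insert \<sigma> (visited d w vs [\<sigma>])"
    using ext_imp_visited[OF \<sigma>(2) refl card_of_mem_faces[OF \<sigma>(1)]] by blast
  have "\<Union>T \<subseteq> {1..n}" using T(1) unfolding faces_def by blast
  moreover have "\<sigma> \<in> T" using w(5) by blast
  ultimately have "\<sigma> \<union> set vs \<subseteq> \<Union>T" "set vs \<subseteq> {1..n}" using w(4) by blast+
  moreover have "w \<in> walk_words d m" using w(1,2) T(2) by (simp add: walk_words_def)
  moreover have "length vs = m - 1" using w(3) T(2) by simp
  ultimately show ?thesis
    using w(5) by (intro that[OF \<sigma>(1), of w vs])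
qed

lemma card_connected_sets_le:
  "card (connected_sets n d m) \<le> n ^ (d + 1) * (d + 2) ^ (2 * (m - 1)) * n ^ (m - 1)"
proof -
  let ?L = "{vs. set vs \<subseteq> {1..n} \<and> length vs = m - 1}"
  let ?X = "faces n d \<times> (walk_words d m \<times> ?L)"
  have fin: "finite ?X" by (intro finite_cartesian_product finite_faces walk_words finite_lists_length_eq) simp
  have "connected_sets n d m \<subseteq> (\<lambda>(\<sigma>, w, vs). insert \<sigma> (visited d w vs [\<sigma>])) ` ?X"
  proof
    fix T assume "T \<in> connected_sets n d m"
    then obtain \<sigma> w vs where "\<sigma> \<in> faces n d" "w \<in> walk_words d m" "set vs \<subseteq> {1..n}"
      "length vs = m - 1" "\<sigma> \<union> set vs \<subseteq> \<Union>T" "T = insert \<sigma> (visited d w vs [\<sigma>])"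
      by (rule connected_set_visited)
    then show "T \<in> (\<lambda>(\<sigma>, w, vs). insert \<sigma> (visited d w vs [\<sigma>])) ` ?X"
      by (intro image_eqI[of _ _ "(\<sigma>, w, vs)"]) auto
  qed
  then have "card (connected_sets n d m) \<le> card ?X"
    using card_mono[OF finite_imageI[OF fin]] card_image_le[OF fin] order_trans by blast
  also have "\<dots> = card (faces n d) * ((d + 2) ^ (2 * (m - 1)) * n ^ (m - 1))"
    using card_lists_length_eq[of "{1..n}" "m - 1"] by (simp add: card_cartesian_product walk_words)
  also have "\<dots> \<le> n ^ (d + 1) * ((d + 2) ^ (2 * (m - 1)) * n ^ (m - 1))"
    by (intro mult_le_mono1 card_faces_le)
  finally show ?thesis by (simp add: mult.assoc)
qed

text \<open>Positive excess leaves at most \<open>m - 1\<close> vertices for a root with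
  \<open>d + 1\<close> vertices and a list of length \<open>m - 1\<close>, so the list has at least
  \<open>d + 1\<close> repetitions. These save the factor \<open>n ^ (d + 1)\<close> spent on the
  root.\<close>

lemma card_connected_sets_excess_le:
  assumes "m \<ge> 1"
  shows "card {T \<in> connected_sets n d m. excess T \<ge> 1} * n ^ (d + 1)
    \<le> n ^ (d + 1) * (d + 2) ^ (2 * (m - 1)) * (2 ^ (m - 1) * n ^ (m - 1) * (d + m) ^ (d + 1))"
proof -
  let ?C = "{T \<in> connected_sets n d m. excess T \<ge> 1}"
  let ?X = "SIGMA \<sigma>:faces n d. walk_words d m \<times> repeating n (m - 1) (d + 1) \<sigma>"
  have fin: "finite ?X"
    by (intro finite_SigmaI finite_cartesian_product finite_faces walk_words finite_repeating)
  have "?C \<subseteq> (\<lambda>(\<sigma>, w, vs). insert \<sigma> (visited d w vs [\<sigma>])) ` ?X"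
  proof
    fix T assume T: "T \<in> ?C"
    then have C: "T \<in> connected_sets n d m" by simp
    obtain \<sigma> w vs where v: "\<sigma> \<in> faces n d" "w \<in> walk_words d m" "set vs \<subseteq> {1..n}"
      "length vs = m - 1" "\<sigma> \<union> set vs \<subseteq> \<Union>T" "T = insert \<sigma> (visited d w vs [\<sigma>])"
      by (rule connected_set_visited[OF C])
    have "\<Union>T \<subseteq> {1..n}" "card T = m" using T by (auto simp: connected_sets_def faces_def)
    then have "card (\<sigma> \<union> set vs) \<le> card (\<Union>T)"
      using v(5) by (intro card_mono) (auto intro: finite_subset)
    then have "card (\<sigma> \<union> set vs) \<le> m - 1"
    proof -
      have "excess T \<ge> 1" using T by simp
      then show ?thesis
        using \<open>card (\<sigma> \<union> set vs) \<le> card (\<Union>T)\<close> unfolding excess_def \<open>card T = m\<close> by linarith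
    qed
    then have "vs \<in> repeating n (m - 1) (d + 1) \<sigma>"
      using v card_of_mem_faces[OF v(1)] unfolding repeating_def by simp
    then show "T \<in> (\<lambda>(\<sigma>, w, vs). insert \<sigma> (visited d w vs [\<sigma>])) ` ?X"
      using v by (intro image_eqI[of _ _ "(\<sigma>, w, vs)"]) auto
  qed
  then have "card ?C \<le> card ?X"
    using card_mono[OF finite_imageI[OF fin]] card_image_le[OF fin] order_trans by blast
  also have "\<dots> = (\<Sum>\<sigma>\<in>faces n d. (d + 2) ^ (2 * (m - 1)) * card (repeating n (m - 1) (d + 1) \<sigma>))"
    by (simp add: card_SigmaI finite_faces walk_words finite_repeating card_cartesian_product)
  finally have "card ?C * n ^ (d + 1)
    \<le> (\<Sum>\<sigma>\<in>faces n d. (d + 2) ^ (2 * (m - 1)) * card (repeating n (m - 1) (d + 1) \<sigma>)) * n ^ (d + 1)"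
    by (rule mult_le_mono1)
  also have "\<dots> = (\<Sum>\<sigma>\<in>faces n d.
      (d + 2) ^ (2 * (m - 1)) * (card (repeating n (m - 1) (d + 1) \<sigma>) * n ^ (d + 1)))"
    unfolding sum_distrib_right by (simp only: mult.assoc)
  also have "\<dots> \<le> (\<Sum>\<sigma>\<in>faces n d.
      (d + 2) ^ (2 * (m - 1)) * (2 ^ (m - 1) * n ^ (m - 1) * (d + m) ^ (d + 1)))"
  proof (intro sum_mono mult_le_mono2)
    fix \<sigma> assume "\<sigma> \<in> faces n d"
    then have "finite \<sigma>" "card \<sigma> + (m - 1) = d + m"
      using finite_of_mem_faces card_of_mem_faces[of \<sigma> n d] assms by auto
    then show "card (repeating n (m - 1) (d + 1) \<sigma>) * n ^ (d + 1)
        \<le> 2 ^ (m - 1) * n ^ (m - 1) * (d + m) ^ (d + 1)"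
      using card_repeating[of \<sigma> n "m - 1" "d + 1"] by simp
  qed
  also have "\<dots> \<le> n ^ (d + 1) * ((d + 2) ^ (2 * (m - 1)) * (2 ^ (m - 1) * n ^ (m - 1) * (d + m) ^ (d + 1)))"
    by (simp only: sum_constant of_nat_id) (intro mult_le_mono1 card_faces_le)
  finally show ?thesis by (simp only: mult.assoc)
qed

subsection \<open>Probability bounds\<close>

text \<open>The iterates of \<open>Rstep\<close> decrease, so one of least cardinality is stable,
  and stability means that no face is free.\<close>

lemma not_collapsible_imp_core:
  assumes S: "finite S" and nc: "\<not> d_collapsible d S"
  obtains K where "K \<subseteq> S" "K \<noteq> {}" "core d K"
proof -
  have sub: "Rstep d X \<subseteq> X" for X unfolding Rstep_def by blast
  have sub': "(Rstep d ^^ i) S \<subseteq> S" for i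
    by (induction i) (use sub in auto)
  obtain i where i: "\<And>j. card ((Rstep d ^^ i) S) \<le> card ((Rstep d ^^ j) S)"
    using ex_has_least_nat[of "\<lambda>_. True" _ "\<lambda>i. card ((Rstep d ^^ i) S)"] by auto
  define K where "K = (Rstep d ^^ i) S"
  have finK: "finite K" unfolding K_def using sub' S finite_subset by blast
  have "card K \<le> card (Rstep d K)" using i[of "Suc i"] unfolding K_def by simp
  then have stable: "Rstep d K = K" using card_seteq[OF finK sub] by blast
  have "core d K"
    unfolding core_def
  proof (intro ballI allI impI)
    fix \<sigma> \<tau> assume \<sigma>: "\<sigma> \<in> K" "\<tau> \<subseteq> \<sigma>" "card \<tau> = d"
    show "\<exists>\<omega>\<in>K. \<omega> \<noteq> \<sigma> \<and> \<tau> \<subseteq> \<omega>"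
    proof (rule ccontr)
      assume "\<not> ?thesis"
      then have "{\<omega> \<in> K. \<tau> \<subseteq> \<omega>} = {\<sigma>}" using \<sigma> by blast
      then have "free_face K \<tau>" unfolding free_face_def by simp
      then have "\<sigma> \<notin> Rstep d K" unfolding Rstep_def using \<sigma> by blast
      then show False using stable \<sigma>(1) by simp
    qed
  qed
  moreover have "K \<noteq> {}" using nc unfolding d_collapsible_def K_def by blast
  ultimately show ?thesis using that sub' unfolding K_def by blast
qed

text \<open>Alternative (a) of the introduction, written as a finite union over sizes and sets for
  the union bound.\<close>

definition dense_event :: "nat \<Rightarrow> nat \<Rightarrow> nat \<Rightarrow> nat set set \<Rightarrow> bool" where
  "dense_event n d N S \<longleftrightarrow> (\<exists>m\<in>{1..N}. \<exists>U\<in>{U \<in> connected_sets n d m. excess U \<ge> 1}. U \<subseteq> S)"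

text \<open>Alternative (b): \<open>M\<close> is the number of free faces required to carry trees
  disjoint from each other and from \<open>T\<close>.\<close>

definition alive_event :: "nat \<Rightarrow> nat \<Rightarrow> nat \<Rightarrow> nat \<Rightarrow> nat \<Rightarrow> nat set set \<Rightarrow> bool" where
  "alive_event n d L k M S \<longleftrightarrow> (\<exists>T\<in>connected_sets n d L. \<exists>G\<in>{G. G \<subseteq> free_faces d T \<and> M \<le> card G}.
     box (\<lambda>X. T \<subseteq> X) (bigbox G (good n k)) S)"

text \<open>The size \<open>L + 2 * s * (d + 1)\<close> allows for \<open>d + 1\<close> pairs of
  trees with at most \<open>s\<close> simplices. Of \<open>L\<close> faces,
  \<open>(d + 1) ^ 2\<close> are given up when estimating \<open>card_free_faces_ge\<close> and
  \<open>(d + 1) * (2 * s * (d + 1))\<close> through the enlargement by trees.\<close>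

lemma not_collapsible_imp_event:
  assumes d: "d \<ge> 2" and S: "S \<subseteq> faces n d" "\<not> d_collapsible d S" "in_F n d S"
    and L: "L \<ge> 1" and s: "s = tsize d k"
  shows "dense_event n d (L + 2 * s * (d + 1)) S \<or>
    alive_event n d L k (L - (d + 1) ^ 2 * (2 * s + 1)) S"
proof (rule disjCI)
  let ?N = "L + 2 * s * (d + 1)"
  assume no: "\<not> alive_event n d L k (L - (d + 1) ^ 2 * (2 * s + 1)) S"
  show "dense_event n d ?N S"
  proof (rule ccontr)
    assume nd: "\<not> dense_event n d ?N S"
    have finS: "finite S" using S(1) finite_faces finite_subset by blast
    obtain K where K: "K \<subseteq> S" "K \<noteq> {}" "core d K"
      by (rule not_collapsible_imp_core[OF finS S(2)])
    obtain \<sigma> where \<sigma>: "\<sigma> \<in> K" using K(2) by blast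
    have KF: "K \<subseteq> faces n d" using K(1) S(1) by blast
    have unif: "\<forall>\<sigma>\<in>K. card \<sigma> = d + 1" using KF card_of_mem_faces by blast
    have finK: "finite K" using K(1) finS finite_subset by blast
    have Kn: "\<Union>K \<subseteq> {1..n}" using KF unfolding faces_def by blast
    have small: "excess U \<le> 0" if U: "ext d {\<sigma>} U" "U \<subseteq> K" "card U \<le> ?N" for U
    proof (rule ccontr)
      assume e: "\<not> excess U \<le> 0"
      have "\<sigma> \<in> U" using ext_subset[OF U(1)] by blast
      moreover have "finite U" using U(2) finK finite_subset by blast
      ultimately have "card U \<ge> 1" using card_gt_0_iff[of U] by fastforce
      moreover have "U \<in> connected_sets n d (card U)"
        unfolding connected_sets_def using U \<sigma> KF by blast
      ultimately have "dense_event n d ?N S"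
        unfolding dense_event_def using e U(2,3) K(1)
        by (intro bexI[of _ "card U"] bexI[of _ U]) auto
      then show False using nd by blast
    qed
    have nb: "\<not> {\<sigma>. \<sigma> \<subseteq> \<rho> \<and> card \<sigma> = d + 1} \<subseteq> K" if "\<rho> \<subseteq> \<Union>K" "card \<rho> = d + 2" for \<rho>
    proof
      assume "{\<sigma>. \<sigma> \<subseteq> \<rho> \<and> card \<sigma> = d + 1} \<subseteq> K"
      moreover have "\<rho> \<in> faces n (d + 1)" using that Kn unfolding faces_def by auto
      ultimately show False using S(3) K(1) unfolding in_F_def by blast
    qed
    obtain T where T: "ext d {\<sigma>} T" "T \<subseteq> K" "card T = L"
      using core_connected_subset[where N = ?N, OF d K(3) unif finK \<sigma> nb small L le_add1] by blast
    have eT: "excess T \<le> 0" using small[OF T(1,2)] T(3) by simp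
    have TC: "T \<in> connected_sets n d L"
      unfolding connected_sets_def using T \<sigma> KF by blast
    obtain G where G: "G \<subseteq> free_faces d T"
      "card (free_faces d T) \<le> card G + (d + 1) * (2 * s * (d + 1))"
      "box (\<lambda>X. T \<subseteq> X) (bigbox G (good n k)) K"
      using core_imp_disjoint_trees[OF K(3) unif finK \<sigma> Kn T(1,2) s] small T(3) by auto
    have "int (card (free_faces d T)) \<ge> int L - (int d + 1) ^ 2"
    proof -
      have "int (card (\<Union>T)) \<ge> int L" using eT T(3) unfolding excess_def by simp
      then have "(int d - 1) * (int (card (\<Union>T)) - int d - 1) \<ge> (int d - 1) * (int L - int d - 1)"
        using d by (intro mult_left_mono) auto
      moreover have "(int d + 1) * (excess T + int d) \<le> (int d + 1) * int d"
        using eT by (intro mult_left_mono) auto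
      moreover have "int (card (free_faces d T)) \<ge> (int d - 1) * (int (card (\<Union>T)) - int d - 1)
          - (int d + 1) * (excess T + int d)"
        using d unif \<sigma> by (intro card_free_faces_ge[OF T(1) refl]) auto
      \<comment> \<open>The two sides differ by \<open>(d - 2) * (L - d - 1)\<close>. For
        \<open>L \<le> (d + 1) ^ 2\<close> the desired lower bound is not positive and holds
        trivially.\<close>
      moreover have "int L - (int d + 1) ^ 2 \<le> (int d - 1) * (int L - int d - 1) - (int d + 1) * int d
        \<or> int L \<le> (int d + 1) ^ 2"
      proof (cases "int L \<le> (int d + 1) ^ 2")
        case False
        moreover have "int d + 1 \<le> (int d + 1) ^ 2" by (rule self_le_power) auto
        ultimately have "0 \<le> (int d - 2) * (int L - int d - 1)"
          using d by (intro mult_nonneg_nonneg) linarith+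
        then show ?thesis by (simp add: power2_eq_square algebra_simps)
      qed simp
      ultimately show ?thesis by linarith
    qed
    then have "int L \<le> int (card (free_faces d T) + (d + 1) ^ 2)"
      by (simp add: add.commute)
    then have "L \<le> card (free_faces d T) + (d + 1) ^ 2"
      by (simp only: of_nat_le_iff)
    moreover have "(d + 1) ^ 2 * (2 * s + 1) = (d + 1) * (2 * s * (d + 1)) + (d + 1) ^ 2"
      by (simp add: power2_eq_square algebra_simps)
    ultimately have "L - (d + 1) ^ 2 * (2 * s + 1) \<le> card G"
      using G(2) by linarith
    then have "alive_event n d L k (L - (d + 1) ^ 2 * (2 * s + 1)) K"
      unfolding alive_event_def using TC G(1,3) by blast
    then have "alive_event n d L k (L - (d + 1) ^ 2 * (2 * s + 1)) S"
      unfolding alive_event_def using upsetD[OF upset_box _ K(1)] by blast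
    then show False using no by blast
  qed
qed

text \<open>Union bound: up to factors in \<open>R\<close> and \<open>m\<close> there are
  \<open>n ^ (m - 1)\<close> sets of size \<open>m\<close>, each present with probability
  \<open>(c / n) ^ m\<close>, which leaves \<open>1 / n\<close>. \<open>R\<close> collects the
  factors per simplex of this and the next bound; \<open>max 1 c\<close> ensures
  \<open>R \<ge> 1\<close>.\<close>

lemma bern_dense_event_le:
  assumes "n \<ge> 1" "0 \<le> c" "c / real n \<le> 1" and R: "R = 2 ^ (d + 1) * (real d + 2) ^ 2 * max 1 c"
  shows "bern (faces n d) (c / real n) (dense_event n d N) \<le> real N * (R ^ N * (real d + real N) ^ (d + 1)) / real n"
proof -
  let ?p = "c / real n"
  let ?U = "\<lambda>m. {U \<in> connected_sets n d m. excess U \<ge> 1}"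
  have p: "0 \<le> ?p" using assms by simp
  have R1: "R \<ge> 1" "R \<ge> 2 * (real d + 2) ^ 2 * c"
  proof -
    have 1: "(1::real) \<le> 2 ^ (d + 1)" "(1::real) \<le> (real d + 2) ^ 2"
      using one_le_power[of "2::real" "d + 1"] one_le_power[of "real d + 2" 2] by auto
    have 2: "(2::real) \<le> 2 ^ (d + 1)" by simp
    have "1 * 1 * 1 \<le> R" unfolding R by (intro mult_mono 1) auto
    then show "R \<ge> 1" by simp
    show "R \<ge> 2 * (real d + 2) ^ 2 * c" unfolding R using assms(2) by (intro mult_mono 2) auto
  qed
  have "bern (faces n d) ?p (dense_event n d N)
      = bern (faces n d) ?p (\<lambda>S. \<exists>m\<in>{1..N}. \<exists>U\<in>?U m. U \<subseteq> S)"
    by (rule bern_cong) (simp only: dense_event_def)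
  also have "\<dots> \<le> (\<Sum>m\<in>{1..N}. bern (faces n d) ?p (\<lambda>S. \<exists>U\<in>?U m. U \<subseteq> S))"
    by (rule bern_Bex_le[OF finite_faces p assms(3)]) simp
  also have "\<dots> \<le> (\<Sum>m\<in>{1..N}. R ^ N * (real d + real N) ^ (d + 1) / real n)"
  proof (rule sum_mono)
    fix m assume m: "m \<in> {1..N}"
    have "bern (faces n d) ?p (\<lambda>S. \<exists>U\<in>?U m. U \<subseteq> S)
        \<le> (\<Sum>U\<in>?U m. bern (faces n d) ?p (\<lambda>S. U \<subseteq> S))"
      by (rule bern_Bex_le[OF finite_faces p assms(3)]) (simp add: finite_connected_sets)
    also have "\<dots> = (\<Sum>U\<in>?U m. ?p ^ m)"
      by (rule sum.cong[OF refl])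
        (subst bern_superset[OF finite_faces], auto simp: connected_sets_def)
    also have "\<dots> = real (card (?U m)) * ?p ^ m" by simp
    also have "\<dots> \<le> R ^ m * (real d + real m) ^ (d + 1) / real n"
    proof -
      have "card (?U m) * n ^ (d + 1)
          \<le> (d + 2) ^ (2 * (m - 1)) * (2 ^ (m - 1) * n ^ (m - 1) * (d + m) ^ (d + 1)) * n ^ (d + 1)"
        using card_connected_sets_excess_le[of m n d] m by (simp add: mult_ac)
      then have "card (?U m)
          \<le> (d + 2) ^ (2 * (m - 1)) * (2 ^ (m - 1) * n ^ (m - 1) * (d + m) ^ (d + 1))"
        using assms(1) by (subst (asm) mult_le_cancel2) auto
      then have "real (card (?U m))
          \<le> real ((d + 2) ^ (2 * (m - 1)) * (2 ^ (m - 1) * n ^ (m - 1) * (d + m) ^ (d + 1)))"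
        by (rule of_nat_mono)
      then have "real (card (?U m)) * ?p ^ m
          \<le> (real d + 2) ^ (2 * (m - 1)) * (2 ^ (m - 1) * real n ^ (m - 1) * (real d + real m) ^ (d + 1)) * ?p ^ m"
        using p by (intro mult_right_mono) (simp_all add: add.commute)
      also have "\<dots> = (2 * (real d + 2) ^ 2) ^ (m - 1) * c ^ m * (real d + real m) ^ (d + 1) / real n"
      proof -
        have "real n ^ m = real n ^ (m - 1) * real n"
          using m by (simp add: power_eq_if)
        then show ?thesis
          using assms(1) by (simp add: power_divide power_mult_distrib power_mult field_simps)
      qed
      also have "\<dots> \<le> R ^ m * (real d + real m) ^ (d + 1) / real n"
      proof (intro divide_right_mono mult_right_mono)
        have "(1::real) * 1 \<le> 2 * (real d + 2) ^ 2" by (intro mult_mono one_le_power) auto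
        then have "(2 * (real d + 2) ^ 2) ^ (m - 1) * c ^ m \<le> (2 * (real d + 2) ^ 2) ^ m * c ^ m"
          using assms(2) by (intro mult_right_mono power_increasing) auto
        also have "\<dots> = (2 * (real d + 2) ^ 2 * c) ^ m" by (simp only: power_mult_distrib)
        also have "\<dots> \<le> R ^ m" using R1 assms(2) by (intro power_mono) auto
        finally show "(2 * (real d + 2) ^ 2) ^ (m - 1) * c ^ m \<le> R ^ m" .
      qed auto
      finally show ?thesis .
    qed
    also have "\<dots> \<le> R ^ N * (real d + real N) ^ (d + 1) / real n"
      using m R1(1) by (intro divide_right_mono mult_mono power_increasing power_mono) auto
    finally show "bern (faces n d) ?p (\<lambda>S. \<exists>U\<in>?U m. U \<subseteq> S) \<le> R ^ N * (real d + real N) ^ (d + 1) / real n" .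
  qed
  also have "\<dots> = real N * (R ^ N * (real d + real N) ^ (d + 1)) / real n" by simp
  finally show ?thesis .
qed

text \<open>There are about \<open>n ^ (d + L)\<close> sets \<open>T\<close>, with at most
  \<open>2 ^ ((d + 1) * L)\<close> choices of \<open>G\<close> each. Disjoint occurrence contributes
  \<open>(c / n) ^ L\<close> for \<open>T\<close> and a factor \<open>\<eta>\<close> per tree, which
  leaves \<open>n ^ d\<close>.\<close>

lemma bern_alive_event_le:
  assumes "n \<ge> 1" "0 \<le> c" "c / real n \<le> 1/2" "L \<ge> 1"
    and R: "R = 2 ^ (d + 1) * (real d + 2) ^ 2 * max 1 c"
    and \<eta>: "surv n d (c / real n) k \<le> \<eta>" "\<eta> \<le> 1"
  shows "bern (faces n d) (c / real n) (alive_event n d L k M) \<le> real n ^ d * R ^ L * \<eta> ^ M"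
proof -
  let ?p = "c / real n"
  let ?C = "connected_sets n d L"
  let ?G = "\<lambda>T. {G. G \<subseteq> free_faces d T \<and> M \<le> card G}"
  have p: "0 \<le> ?p" "?p \<le> 1" using assms by auto
  have \<eta>0: "0 \<le> \<eta>" using surv_bounds(1)[OF p] \<eta>(1) order_trans by blast
  have TC: "finite T" "\<forall>\<sigma>\<in>T. card \<sigma> = d + 1" "T \<subseteq> faces n d" "card T = L" if "T \<in> ?C" for T
  proof -
    show T: "T \<subseteq> faces n d" "card T = L" using that by (auto simp: connected_sets_def)
    show "finite T" using T(1) finite_faces finite_subset by blast
    show "\<forall>\<sigma>\<in>T. card \<sigma> = d + 1" using T(1) card_of_mem_faces by blast
  qed
  have finG: "finite (?G T)" if "T \<in> ?C" for T
    using card_free_faces_le(1)[OF TC(1,2)[OF that]] by simp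
  have "bern (faces n d) ?p (alive_event n d L k M)
      = bern (faces n d) ?p (\<lambda>S. \<exists>T\<in>?C. \<exists>G\<in>?G T. box (\<lambda>X. T \<subseteq> X) (bigbox G (good n k)) S)"
    by (rule bern_cong) (simp only: alive_event_def)
  also have "\<dots> \<le> (\<Sum>T\<in>?C. bern (faces n d) ?p
      (\<lambda>S. \<exists>G\<in>?G T. box (\<lambda>X. T \<subseteq> X) (bigbox G (good n k)) S))"
    by (rule bern_Bex_le[OF finite_faces p finite_connected_sets])
  also have "\<dots> \<le> (\<Sum>T\<in>?C. 2 ^ ((d + 1) * L) * (?p ^ L * \<eta> ^ M))"
  proof (rule sum_mono)
    fix T assume T: "T \<in> ?C"
    note T' = TC[OF T]
    note FF = card_free_faces_le[OF T'(1,2)]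
    have "bern (faces n d) ?p (\<lambda>S. \<exists>G\<in>?G T. box (\<lambda>X. T \<subseteq> X) (bigbox G (good n k)) S)
        \<le> (\<Sum>G\<in>?G T. bern (faces n d) ?p (box (\<lambda>X. T \<subseteq> X) (bigbox G (good n k))))"
      by (rule bern_Bex_le[OF finite_faces p finG[OF T]])
    also have "\<dots> \<le> (\<Sum>G\<in>?G T. ?p ^ L * \<eta> ^ M)"
    proof (rule sum_mono)
      fix G assume G: "G \<in> ?G T"
      have "bern (faces n d) ?p (box (\<lambda>X. T \<subseteq> X) (bigbox G (good n k)))
          \<le> ?p ^ card T * \<eta> ^ card G"
      proof (rule bern_box_superset_le[OF p(1) assms(3) finite_faces T'(3) _ upset_good])
        show "finite G" using G FF(1) finite_subset by blast
        fix f assume "f \<in> G"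
        then have f: "f \<in> free_faces d T" using G by blast
        then have "f \<subseteq> {1..n}" "card f = d"
          using free_faces_Union[OF f] T'(3) unfolding faces_def free_faces_def by blast+
        then show "bern (faces n d) ?p (good n k f) \<le> \<eta>"
          using bern_good_le[OF p(1) assms(3)] \<eta>(1) order_trans by blast
      qed
      also have "\<dots> \<le> ?p ^ L * \<eta> ^ M"
        unfolding T'(4) using G p(1) \<eta>0 \<eta>(2) by (intro mult_left_mono power_decreasing) auto
      finally show "bern (faces n d) ?p (box (\<lambda>X. T \<subseteq> X) (bigbox G (good n k))) \<le> ?p ^ L * \<eta> ^ M" .
    qed
    also have "\<dots> = real (card (?G T)) * (?p ^ L * \<eta> ^ M)" by simp
    also have "\<dots> \<le> 2 ^ ((d + 1) * L) * (?p ^ L * \<eta> ^ M)"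
    proof (rule mult_right_mono)
      have "card (?G T) \<le> card (Pow (free_faces d T))"
        using FF(1) by (intro card_mono) auto
      also have "\<dots> = 2 ^ card (free_faces d T)" by (rule card_Pow[OF FF(1)])
      also have "\<dots> \<le> 2 ^ ((d + 1) * L)" using FF(2) T'(4) by (intro power_increasing) auto
      finally have "real (card (?G T)) \<le> real (2 ^ ((d + 1) * L))" by (rule of_nat_mono)
      then show "real (card (?G T)) \<le> 2 ^ ((d + 1) * L)" by simp
    qed (use p(1) \<eta>0 in auto)
    finally show "bern (faces n d) ?p (\<lambda>S. \<exists>G\<in>?G T. box (\<lambda>X. T \<subseteq> X) (bigbox G (good n k)) S)
        \<le> 2 ^ ((d + 1) * L) * (?p ^ L * \<eta> ^ M)" .
  qed
  also have "\<dots> = real (card ?C) * (2 ^ ((d + 1) * L) * (?p ^ L * \<eta> ^ M))" by simp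
  also have "\<dots> \<le> (real n ^ (d + 1) * (real d + 2) ^ (2 * (L - 1)) * real n ^ (L - 1))
      * (2 ^ ((d + 1) * L) * (?p ^ L * \<eta> ^ M))"
  proof (rule mult_right_mono)
    have "real (card ?C) \<le> real (n ^ (d + 1) * (d + 2) ^ (2 * (L - 1)) * n ^ (L - 1))"
      by (rule of_nat_mono[OF card_connected_sets_le])
    then show "real (card ?C) \<le> real n ^ (d + 1) * (real d + 2) ^ (2 * (L - 1)) * real n ^ (L - 1)"
      by (simp add: add.commute)
  qed (use p(1) \<eta>0 in auto)
  also have "\<dots> = real n ^ d * (((real d + 2) ^ 2) ^ (L - 1) * (2 ^ (d + 1)) ^ L * c ^ L) * \<eta> ^ M"
  proof -
    have "real n ^ L = real n ^ (L - 1) * real n"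
      using assms(4) by (simp add: power_eq_if)
    moreover have "(2::real) ^ ((d + 1) * L) = (2 ^ (d + 1)) ^ L"
      by (rule power_mult)
    ultimately show ?thesis
      using assms(1) by (simp add: power_divide power_mult[of _ 2] field_simps)
  qed
  also have "\<dots> \<le> real n ^ d * R ^ L * \<eta> ^ M"
  proof (intro mult_left_mono mult_right_mono)
    have "((real d + 2) ^ 2) ^ (L - 1) * (2 ^ (d + 1)) ^ L * c ^ L
        \<le> ((real d + 2) ^ 2) ^ L * (2 ^ (d + 1)) ^ L * (max 1 c) ^ L"
      using assms(2) by (intro mult_mono power_increasing power_mono one_le_power) auto
    also have "\<dots> = R ^ L" unfolding R by (simp only: power_mult_distrib mult_ac)
    finally show "((real d + 2) ^ 2) ^ (L - 1) * (2 ^ (d + 1)) ^ L * c ^ L \<le> R ^ L" .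
  qed (use \<eta>0 in auto)
  finally show ?thesis .
qed

subsection \<open>Limits\<close>

text \<open>The recursion of \<open>surv\<close> for \<open>p = c / n\<close> as \<open>n\<close>
  tends to infinity.\<close>

primrec surv_lim :: "nat \<Rightarrow> real \<Rightarrow> nat \<Rightarrow> real" where
  "surv_lim d c 0 = 1"
| "surv_lim d c (Suc k) = 1 - exp (- c * surv_lim d c k ^ d)"

lemma surv_lim_nonneg: "0 \<le> c \<Longrightarrow> 0 \<le> surv_lim d c k"
  by (induction k) auto

lemma surv_lim_antimono:
  assumes "0 \<le> c"
  shows "surv_lim d c (Suc k) \<le> surv_lim d c k"
proof (induction k)
  case (Suc k)
  have "surv_lim d c (Suc k) ^ d \<le> surv_lim d c k ^ d"
    by (rule power_mono[OF Suc surv_lim_nonneg[OF assms]])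
  then have "c * surv_lim d c (Suc k) ^ d \<le> c * surv_lim d c k ^ d"
    using assms by (rule mult_left_mono)
  then show ?case by (simp del: surv_lim.simps add: surv_lim.simps(2)[of d c "Suc k"] surv_lim.simps(2)[of d c k])
qed simp

text \<open>The sequence decreases to a fixed point \<open>l\<close>. If \<open>l\<close> were
  positive, \<open>x = 1 - l\<close> would solve the equation defining \<open>gamma_d\<close> for
  \<open>\<gamma> = c\<close>.\<close>

lemma surv_lim_tendsto_0:
  assumes c: "0 \<le> c" "c < gamma_d d"
  shows "surv_lim d c \<longlonglongrightarrow> 0"
proof -
  have dec: "decseq (surv_lim d c)"
    by (rule decseq_SucI) (rule surv_lim_antimono[OF c(1)])
  have "\<forall>k. 0 \<le> surv_lim d c k" using surv_lim_nonneg[OF c(1)] by blast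
  then obtain l where l: "surv_lim d c \<longlonglongrightarrow> l" "\<forall>k. l \<le> surv_lim d c k"
    by (rule decseq_convergent[OF dec])
  have "0 \<le> l" by (rule LIMSEQ_le_const[OF l(1)]) (use surv_lim_nonneg[OF c(1)] in auto)
  have "(\<lambda>k. 1 - exp (- c * surv_lim d c k ^ d)) \<longlonglongrightarrow> 1 - exp (- c * l ^ d)"
    by (intro tendsto_intros l(1))
  moreover have "(\<lambda>k. 1 - exp (- c * surv_lim d c k ^ d)) \<longlonglongrightarrow> l"
    using LIMSEQ_Suc[OF l(1)] by simp
  ultimately have fp: "l = 1 - exp (- c * l ^ d)" using LIMSEQ_unique by blast
  have "l = 0"
  proof (rule ccontr)
    assume "l \<noteq> 0"
    then have "1 - l < 1" using \<open>0 \<le> l\<close> by simp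
    moreover have "exp (- c * (1 - (1 - l)) ^ d) = 1 - l" using fp by simp
    ultimately have "c \<in> {\<gamma>. \<gamma> \<ge> 0 \<and> (\<exists>x::real. x < 1 \<and> exp (- \<gamma> * (1 - x) ^ d) = x)}"
      using c(1) by blast
    then have "gamma_d d \<le> c"
      unfolding gamma_d_def by (rule cInf_lower) (auto intro: bdd_belowI[of _ 0])
    then show False using c(2) by simp
  qed
  then show ?thesis using l(1) by simp
qed

text \<open>The strict inequality leaves room for a \<open>w\<close> slightly above the limit value
  at depth \<open>k\<close>, and then \<open>(1 - c * w ^ d / n) ^ n\<close> tends to
  \<open>exp (- c * w ^ d)\<close>.\<close>

lemma surv_eventually_le:
  assumes c: "0 \<le> c"
  shows "surv_lim d c k < u \<Longrightarrow> eventually (\<lambda>n. surv n d (c / real n) k \<le> u) sequentially"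
proof (induction k arbitrary: u)
  case 0
  then show ?case by simp
next
  case (Suc k)
  let ?t = "surv_lim d c k"
  have "((\<lambda>w. 1 - exp (- c * w ^ d)) \<longlongrightarrow> 1 - exp (- c * ?t ^ d)) (at_right ?t)"
    by (intro tendsto_intros)
  then have "eventually (\<lambda>w. 1 - exp (- c * w ^ d) < u) (at_right ?t)"
    using Suc.prems by (intro order_tendstoD(2)[of _ "1 - exp (- c * ?t ^ d)"]) auto
  then obtain b where b: "b > ?t" "\<And>y. y > ?t \<Longrightarrow> y < b \<Longrightarrow> 1 - exp (- c * y ^ d) < u"
    unfolding eventually_at_right_field by blast
  obtain w where w: "?t < w" "w < b" using dense[OF b(1)] by blast
  have wu: "1 - exp (- c * w ^ d) < u" by (rule b(2)[OF w])
  have w0: "0 \<le> w" using w(1) surv_lim_nonneg[OF c, of d k] by linarith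
  have "(\<lambda>n. 1 - (1 + (- c * w ^ d) / real n) ^ n) \<longlonglongrightarrow> 1 - exp (- c * w ^ d)"
    by (intro tendsto_intros tendsto_exp_limit_sequentially)
  then have "eventually (\<lambda>n. 1 - (1 + (- c * w ^ d) / real n) ^ n < u) sequentially"
    using wu by (rule order_tendstoD(2))
  moreover have "eventually (\<lambda>n. surv n d (c / real n) k \<le> w) sequentially"
    by (rule Suc.IH[OF w(1)])
  \<comment> \<open>Makes \<open>c / n\<close> at most 1 and the base
    \<open>1 - c * w ^ d / n\<close> nonnegative.\<close>
  moreover have "eventually (\<lambda>n. c * w ^ d + c \<le> real n) sequentially"
    by (rule eventually_sequentiallyI[of "nat \<lceil>c * w ^ d + c\<rceil>"]) linarith
  moreover have "eventually (\<lambda>n::nat. 1 \<le> n) sequentially" by (rule eventually_ge_at_top)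
  ultimately show ?case
  proof eventually_elim
    case (elim n)
    have cw: "0 \<le> c * w ^ d" using c w0 by simp
    have p: "0 \<le> c / real n" "c / real n \<le> 1" using elim(3,4) c cw by (auto simp: field_simps)
    have "surv n d (c / real n) k ^ d \<le> w ^ d"
      by (rule power_mono[OF elim(2) surv_bounds(1)[OF p]])
    then have "c / real n * surv n d (c / real n) k ^ d \<le> c / real n * w ^ d"
      using p(1) by (rule mult_left_mono)
    then have "1 + (- c * w ^ d) / real n \<le> 1 - c / real n * surv n d (c / real n) k ^ d"
      by simp
    moreover have "0 \<le> 1 + (- c * w ^ d) / real n"
      using elim(3,4) c by (simp add: field_simps)
    ultimately have "(1 + (- c * w ^ d) / real n) ^ n
        \<le> (1 - c / real n * surv n d (c / real n) k ^ d) ^ n"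
      by (rule power_mono)
    then show ?case using elim(1) by simp
  qed
qed

section \<open>Lower bound for the probability of the conditioning event\<close>

lemma exp_minus_two_le:
  assumes "0 \<le> q" "q \<le> 1/2"
  shows "exp (- 2 * q) \<le> 1 - (q::real)"
proof -
  have "- 2 * q \<le> - q - 2 * q\<^sup>2"
    using mult_left_mono[OF assms(2,1)] by (simp add: power2_eq_square)
  also have "\<dots> \<le> ln (1 - q)" by (rule ln_one_minus_pos_lower_bound[OF assms])
  finally have "exp (- 2 * q) \<le> exp (ln (1 - q))" by simp
  then show ?thesis using assms(2) by simp
qed

text \<open>By Harris, avoiding all boundaries is at least as likely as under independence. There
  are at most \<open>n ^ (d + 2)\<close> of them, each present with probability
  \<open>(c / n) ^ (d + 2)\<close>, so the product stays above a constant.\<close>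

lemma bern_in_F_ge:
  assumes "n \<ge> 1" "0 \<le> c" "c / real n \<le> 1/2"
  shows "exp (- 2 * c ^ (d + 2)) \<le> bern (faces n d) (c / real n) (in_F n d)"
proof -
  let ?p = "c / real n"
  let ?q = "?p ^ (d + 2)"
  have p: "0 \<le> ?p" "?p \<le> 1" using assms by auto
  have q0: "0 \<le> ?q" using p(1) by (rule zero_le_power)
  have "?q = ?p * ?p ^ (d + 1)" by simp
  also have "\<dots> \<le> 1/2 * 1"
    by (rule mult_mono[OF assms(3) power_le_one[OF p] _ zero_le_power[OF p(1)]]) simp
  finally have q: "?q \<le> 1/2" by simp
  have e: "exp (- 2 * ?q) \<le> 1 - ?q" by (rule exp_minus_two_le[OF q0 q])
  have "exp (- 2 * c ^ (d + 2)) = exp (- 2 * ?q) ^ (n ^ (d + 2))"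
    using assms(1) unfolding exp_of_nat_mult[symmetric] by (simp add: power_divide)
  also have "\<dots> \<le> (1 - ?q) ^ (n ^ (d + 2))" using e by (rule power_mono) simp
  also have "\<dots> \<le> (1 - ?q) ^ card (faces n (d + 1))"
  proof (rule power_decreasing)
    show "card (faces n (d + 1)) \<le> n ^ (d + 2)" using card_faces_le[of n "d + 1"] by simp
    show "0 \<le> 1 - ?q" "1 - ?q \<le> 1" using q q0 by linarith+
  qed
  also have "\<dots> = (\<Prod>\<rho>\<in>faces n (d + 1). 1 - ?q)" by simp
  also have "\<dots> = (\<Prod>\<rho>\<in>faces n (d + 1).
      1 - bern (faces n d) ?p (\<lambda>S. {\<sigma>. \<sigma> \<subseteq> \<rho> \<and> card \<sigma> = d + 1} \<subseteq> S))"
  proof (rule prod.cong[OF refl])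
    fix \<rho> assume \<rho>: "\<rho> \<in> faces n (d + 1)"
    then have "card \<rho> = (d + 1) + 1" "\<rho> \<subseteq> {1..n}" by (auto simp: faces_def)
    then have "{\<sigma>. \<sigma> \<subseteq> \<rho> \<and> card \<sigma> = d + 1} \<subseteq> faces n d"
      "card {\<sigma>. \<sigma> \<subseteq> \<rho> \<and> card \<sigma> = d + 1} = d + 2"
      using card_facets(1)[of \<rho> "d + 1"] by (auto simp: faces_def)
    then show "1 - ?q = 1 - bern (faces n d) ?p (\<lambda>S. {\<sigma>. \<sigma> \<subseteq> \<rho> \<and> card \<sigma> = d + 1} \<subseteq> S)"
      by (simp only: bern_superset[OF finite_faces])
  qed
  also have "\<dots> \<le> bern (faces n d) ?p
      (\<lambda>S. \<not> (\<exists>\<rho>\<in>faces n (d + 1). {\<sigma>. \<sigma> \<subseteq> \<rho> \<and> card \<sigma> = d + 1} \<subseteq> S))"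
    by (rule harris_prod[OF finite_faces p finite_faces]) (rule upset_superset)
  also have "\<dots> = bern (faces n d) ?p (in_F n d)"
    by (rule bern_cong) (simp only: in_F_def)
  finally show ?thesis .
qed

section \<open>Choice of the parameters and passage to the limit\<close>

lemma power_le_fact_exp: "0 \<le> (x::real) \<Longrightarrow> x ^ k \<le> fact k * exp x"
proof -
  assume x: "0 \<le> x"
  have "x ^ k /\<^sub>R fact k \<le> (\<Sum>j\<in>{..k}. x ^ j /\<^sub>R fact j)"
    using x by (intro member_le_sum) auto
  also have "\<dots> \<le> exp x"
    unfolding exp_def using x summable_exp_generic[of x] by (intro sum_le_suminf) auto
  finally show ?thesis by (simp add: field_simps)
qed

text \<open>With \<open>L \<approx> \<epsilon> ln n\<close> the number \<open>\<epsilon>\<close> is chosen such that the exponential factor \<open>(e R)\<^sup>L\<close> in the bound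
for dense subcomplexes stays below \<open>\<surd>n\<close>, and then the depth \<open>k\<close> is chosen such that the survival
probability to the power \<open>L\<close> beats \<open>n\<^sup>d R\<^sup>L\<close>.\<close>

lemma bern_not_collapsible_tendsto_0:
  assumes d: "d \<ge> 2" and c: "0 \<le> c" "c < gamma_d d"
  shows "(\<lambda>n. bern (faces n d) (c / real n) (\<lambda>S. \<not> d_collapsible d S \<and> in_F n d S)) \<longlonglongrightarrow> 0"
proof -
  define R :: real where "R = 2 ^ (d + 1) * (real d + 2) ^ 2 * max 1 c"
  have "(1::real) \<le> 2 ^ (d + 1)" "(1::real) \<le> (real d + 2) ^ 2"
    using one_le_power[of "2::real" "d + 1"] one_le_power[of "real d + 2" 2] by auto
  then have "1 * 1 * 1 \<le> R" unfolding R_def by (intro mult_mono) auto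
  then have R1: "1 \<le> R" by simp
  define \<epsilon> where "\<epsilon> = 1 / (2 * (1 + ln R))"
  have lnR: "0 \<le> ln R" using R1 by simp
  have \<epsilon>: "0 < \<epsilon>" "\<epsilon> * (1 + ln R) = 1/2" unfolding \<epsilon>_def using lnR by (auto simp: field_simps)
  \<comment> \<open>Makes \<open>exp (- \<theta> * L)\<close> at most a constant times
    \<open>1 / n ^ (d + 1)\<close>, which beats \<open>n ^ d\<close>; \<open>\<eta>\<close> is then
    the survival bound with \<open>R * \<eta> = exp (- \<theta>)\<close>.\<close>
  define \<theta> where "\<theta> = (real d + 1) / \<epsilon>"
  have \<theta>: "0 \<le> \<theta>" "\<theta> * \<epsilon> = real d + 1" unfolding \<theta>_def using \<epsilon> by auto
  define \<eta> where "\<eta> = exp (- \<theta>) / R"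
  have \<eta>: "0 < \<eta>" "\<eta> \<le> 1" "R * \<eta> = exp (- \<theta>)"
    unfolding \<eta>_def using R1 \<theta>(1) by (auto simp: field_simps intro: order_trans[of _ 1])
  have "eventually (\<lambda>k. surv_lim d c k < \<eta>) sequentially"
    by (rule order_tendstoD(2)[OF surv_lim_tendsto_0[OF c] \<eta>(1)])
  then obtain k where k: "surv_lim d c k < \<eta>" by (auto simp: eventually_sequentially)
  define s where "s = tsize d k"
  define b where "b = 2 * s * (d + 1)"
  define b' where "b' = (d + 1) ^ 2 * (2 * s + 1)"
  define L where "L n = nat \<lfloor>\<epsilon> * ln (real n)\<rfloor>" for n :: nat
  define C1 where "C1 = fact (d + 2) * (exp (real d + real b) * R ^ b)"
  define C2 where "C2 = exp \<theta> / \<eta> ^ b'"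
  have ub: "eventually (\<lambda>n. bern (faces n d) (c / real n) (\<lambda>S. \<not> d_collapsible d S \<and> in_F n d S)
      \<le> C1 / sqrt (real n) + C2 / real n) sequentially"
  proof -
    have "eventually (\<lambda>n. 2 * c \<le> real n) sequentially"
      by (rule eventually_sequentiallyI[of "nat \<lceil>2 * c\<rceil>"]) linarith
    moreover have "eventually (\<lambda>n::nat. 1 \<le> n) sequentially" by (rule eventually_ge_at_top)
    \<comment> \<open>Ensures \<open>L n \<ge> 1\<close>.\<close>
    moreover have "eventually (\<lambda>n. exp (1 / \<epsilon>) \<le> real n) sequentially"
      by (rule eventually_sequentiallyI[of "nat \<lceil>exp (1 / \<epsilon>)\<rceil>"]) linarith
    moreover have "eventually (\<lambda>n. surv n d (c / real n) k \<le> \<eta>) sequentially"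
      by (rule surv_eventually_le[OF c(1) k])
    ultimately show ?thesis
    proof eventually_elim
      case (elim n)
      let ?p = "c / real n"
      let ?N = "L n + b"
      have n0: "0 < real n" using elim(2) by simp
      have p: "0 \<le> ?p" "?p \<le> 1/2" "?p \<le> 1" using elim(1) n0 c(1) by (auto simp: field_simps)
      have "1 / \<epsilon> \<le> ln (real n)" using elim(3) n0 by (simp add: ln_ge_iff)
      then have "1 \<le> \<epsilon> * ln (real n)" using \<epsilon>(1) by (simp add: field_simps)
      then have L: "1 \<le> L n" "real (L n) \<le> \<epsilon> * ln (real n)" "\<epsilon> * ln (real n) - 1 \<le> real (L n)"
        unfolding L_def by linarith+
      have "bern (faces n d) ?p (\<lambda>S. \<not> d_collapsible d S \<and> in_F n d S)
          \<le> bern (faces n d) ?p (\<lambda>S. dense_event n d ?N S \<or> alive_event n d (L n) k (L n - b') S)"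
      proof (rule bern_mono[OF finite_faces p(1,3)])
        fix S assume "S \<subseteq> faces n d" "\<not> d_collapsible d S \<and> in_F n d S"
        then show "dense_event n d ?N S \<or> alive_event n d (L n) k (L n - b') S"
          unfolding b_def b'_def using not_collapsible_imp_event[OF d _ _ _ L(1) s_def] by blast
      qed
      also have "\<dots> \<le> bern (faces n d) ?p (dense_event n d ?N)
          + bern (faces n d) ?p (alive_event n d (L n) k (L n - b'))"
        unfolding bern_disj[OF finite_faces] using bern_nonneg[OF p(1,3)] by simp
      also have "\<dots> \<le> C1 / sqrt (real n) + C2 / real n"
      proof (rule add_mono)
        have "bern (faces n d) ?p (dense_event n d ?N)
            \<le> real ?N * (R ^ ?N * (real d + real ?N) ^ (d + 1)) / real n"
          by (rule bern_dense_event_le[OF elim(2) c(1) p(3) R_def])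
        also have "\<dots> \<le> C1 * sqrt (real n) / real n"
        proof (rule divide_right_mono)
          have "real ?N * (R ^ ?N * (real d + real ?N) ^ (d + 1))
              \<le> (real d + real ?N) * (R ^ ?N * (real d + real ?N) ^ (d + 1))"
            using R1 by (intro mult_right_mono) auto
          also have "\<dots> = R ^ ?N * (real d + real ?N) ^ (d + 2)" by simp
          \<comment> \<open>The polynomial factor is absorbed into an exponential, which is why
            \<open>\<epsilon>\<close> is defined with \<open>1 + ln R\<close>.\<close>
          also have "\<dots> \<le> R ^ ?N * (fact (d + 2) * exp (real d + real ?N))"
            using R1 by (intro mult_left_mono power_le_fact_exp) auto
          also have "\<dots> = C1 * (R ^ L n * exp (real (L n)))"
            unfolding C1_def by (simp add: power_add exp_add)
          also have "R ^ L n * exp (real (L n)) = exp (real (L n) * (1 + ln R))"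
          proof -
            have "R ^ L n = exp (real (L n) * ln R)"
              using R1 by (simp add: exp_of_nat_mult)
            then show ?thesis by (simp add: exp_add[symmetric] algebra_simps)
          qed
          also have "C1 * exp (real (L n) * (1 + ln R)) \<le> C1 * exp (ln (real n) / 2)"
          proof (rule mult_left_mono)
            have "real (L n) * (1 + ln R) \<le> (\<epsilon> * ln (real n)) * (1 + ln R)"
              using L(2) lnR by (intro mult_right_mono) auto
            also have "\<dots> = (\<epsilon> * (1 + ln R)) * ln (real n)" by simp
            finally show "exp (real (L n) * (1 + ln R)) \<le> exp (ln (real n) / 2)"
              unfolding \<epsilon>(2) by simp
            show "0 \<le> C1" unfolding C1_def using R1 by simp
          qed
          also have "exp (ln (real n) / 2) = sqrt (real n)"
            using n0 by (simp add: ln_sqrt[symmetric])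
          finally show "real ?N * (R ^ ?N * (real d + real ?N) ^ (d + 1)) \<le> C1 * sqrt (real n)" .
        qed simp
        also have "\<dots> = C1 / sqrt (real n)"
          using n0 by (simp add: field_simps flip: real_sqrt_mult)
        finally show "bern (faces n d) ?p (dense_event n d ?N) \<le> C1 / sqrt (real n)" .
        have "bern (faces n d) ?p (alive_event n d (L n) k (L n - b'))
            \<le> real n ^ d * R ^ L n * \<eta> ^ (L n - b')"
          by (rule bern_alive_event_le[OF elim(2) c(1) p(2) L(1) R_def elim(4) \<eta>(2)])
        also have "\<dots> \<le> real n ^ d * R ^ L n * (\<eta> ^ L n / \<eta> ^ b')"
        proof (rule mult_left_mono)
          \<comment> \<open>The subtraction is truncated, but
            \<open>(L n - b') + b' \<ge> L n\<close> holds in any case.\<close>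
          have "\<eta> ^ (L n - b') * \<eta> ^ b' \<le> \<eta> ^ L n"
            unfolding power_add[symmetric] using \<eta>(1,2) by (intro power_decreasing) auto
          then show "\<eta> ^ (L n - b') \<le> \<eta> ^ L n / \<eta> ^ b'" using \<eta>(1) by (simp add: field_simps)
        qed (use R1 in auto)
        also have "\<dots> = real n ^ d * (R * \<eta>) ^ L n / \<eta> ^ b'" by (simp add: power_mult_distrib)
        also have "\<dots> = real n ^ d * exp (- (\<theta> * real (L n))) / \<eta> ^ b'"
          unfolding \<eta>(3) exp_of_nat_mult[symmetric] by (simp add: mult.commute)
        also have "\<dots> \<le> real n ^ d * (exp \<theta> / real n ^ (d + 1)) / \<eta> ^ b'"
        proof (intro divide_right_mono mult_left_mono)
          have "\<theta> * (\<epsilon> * ln (real n) - 1) \<le> \<theta> * real (L n)"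
            by (rule mult_left_mono[OF L(3) \<theta>(1)])
          then have "(\<theta> * \<epsilon>) * ln (real n) - \<theta> \<le> \<theta> * real (L n)" by (simp add: algebra_simps)
          then have "exp (- (\<theta> * real (L n))) \<le> exp (\<theta> - real (d + 1) * ln (real n))"
            unfolding \<theta>(2) by (simp add: add.commute)
          also have "\<dots> = exp \<theta> / real n ^ (d + 1)"
            unfolding exp_diff exp_of_nat_mult using n0 by simp
          finally show "exp (- (\<theta> * real (L n))) \<le> exp \<theta> / real n ^ (d + 1)" .
        qed (use \<eta>(1) in auto)
        also have "\<dots> = C2 / real n" unfolding C2_def using n0 by simp
        finally show "bern (faces n d) ?p (alive_event n d (L n) k (L n - b')) \<le> C2 / real n" .
      qed
      finally show ?case .
    qed
  qed
  have sq: "filterlim (\<lambda>n. sqrt (real n)) at_top sequentially"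
    by (rule filterlim_compose[OF sqrt_at_top filterlim_real_sequentially])
  have "(\<lambda>n. C1 / sqrt (real n) + C2 / real n) \<longlonglongrightarrow> 0 + 0"
    by (intro tendsto_add tendsto_divide_0[OF tendsto_const] filterlim_at_top_imp_at_infinity sq
        filterlim_real_sequentially)
  then have lim: "(\<lambda>n. C1 / sqrt (real n) + C2 / real n) \<longlonglongrightarrow> 0" by simp
  have "eventually (\<lambda>n. 0 \<le> bern (faces n d) (c / real n) (\<lambda>S. \<not> d_collapsible d S \<and> in_F n d S)) sequentially"
  proof (rule eventually_sequentiallyI[of "nat \<lceil>c\<rceil> + 1"])
    fix n assume n: "nat \<lceil>c\<rceil> + 1 \<le> n"
    then have "c \<le> real n" by linarith
    then have "0 \<le> c / real n" "c / real n \<le> 1" using c(1) n by (auto simp: field_simps)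
    then show "0 \<le> bern (faces n d) (c / real n) (\<lambda>S. \<not> d_collapsible d S \<and> in_F n d S)"
      by (rule bern_nonneg)
  qed
  then show ?thesis by (rule tendsto_sandwich[OF _ ub tendsto_const lim])
qed

theorem theorem4:
  fixes d :: nat and c :: real
  assumes "d \<ge> 2" and "0 \<le> c" and "c < gamma_d d"
  shows "(\<lambda>n. cond_prob_Y n d (c / real n) (d_collapsible d) (in_F n d)) \<longlonglongrightarrow> 1"
proof -
  define B where "B n = bern (faces n d) (c / real n) (\<lambda>S. \<not> d_collapsible d S \<and> in_F n d S)" for n
  define F where "F n = bern (faces n d) (c / real n) (in_F n d)" for n
  define \<delta> where "\<delta> = exp (- 2 * c ^ (d + 2))"
  have B: "B \<longlonglongrightarrow> 0" unfolding B_def by (rule bern_not_collapsible_tendsto_0[OF assms])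
  have ev: "eventually (\<lambda>n. 2 * c + 1 \<le> real n) sequentially"
    by (rule eventually_sequentiallyI[of "nat \<lceil>2 * c + 1\<rceil>"]) linarith
  have p: "1 \<le> n" "0 \<le> c / real n" "c / real n \<le> 1/2" if "2 * c + 1 \<le> real n" for n
    using that assms(2) by (auto simp: field_simps)
  have F: "eventually (\<lambda>n. \<delta> \<le> F n) sequentially"
    using ev
  proof eventually_elim
    case (elim n)
    then show ?case unfolding F_def \<delta>_def by (intro bern_in_F_ge p assms(2))
  qed
  have \<delta>: "0 < \<delta>" unfolding \<delta>_def by simp
  \<comment> \<open>\<open>F\<close> stays above the positive constant \<open>\<delta>\<close>, so
    dividing by it preserves the limit 0.\<close>
  have "(\<lambda>n. B n / F n) \<longlonglongrightarrow> 0"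
  proof (rule tendsto_sandwich[OF _ _ tendsto_const])
    show "eventually (\<lambda>n. 0 \<le> B n / F n) sequentially"
      using ev F
    proof eventually_elim
      case (elim n)
      have "0 \<le> B n" unfolding B_def using p[OF elim(1)] by (intro bern_nonneg) auto
      then show ?case using elim(2) \<delta> by simp
    qed
    show "eventually (\<lambda>n. B n / F n \<le> B n / \<delta>) sequentially"
      using ev F
    proof eventually_elim
      case (elim n)
      have "0 \<le> B n" unfolding B_def using p[OF elim(1)] by (intro bern_nonneg) auto
      then show ?case using elim(2) \<delta> by (intro divide_left_mono) auto
    qed
    show "(\<lambda>n. B n / \<delta>) \<longlonglongrightarrow> 0" using tendsto_divide[OF B tendsto_const, of \<delta>] \<delta> by simp
  qed
  then have "(\<lambda>n. 1 - B n / F n) \<longlonglongrightarrow> 1 - 0" by (intro tendsto_diff tendsto_const)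
  \<comment> \<open>The identity requires \<open>F n\<close> to be nonzero, which holds for all
    large \<open>n\<close>.\<close>
  moreover have "eventually (\<lambda>n. 1 - B n / F n
      = cond_prob_Y n d (c / real n) (d_collapsible d) (in_F n d)) sequentially"
    using F
  proof eventually_elim
    case (elim n)
    let ?A = "bern (faces n d) (c / real n) (\<lambda>S. d_collapsible d S \<and> in_F n d S)"
    have "F n = bern (faces n d) (c / real n)
        (\<lambda>S. (d_collapsible d S \<and> in_F n d S) \<or> (\<not> d_collapsible d S \<and> in_F n d S))"
      unfolding F_def by (rule bern_cong) blast
    also have "\<dots> = ?A + B n - bern (faces n d) (c / real n) (\<lambda>S. False)"
      unfolding bern_disj[OF finite_faces] B_def
      by (intro arg_cong2[where f = "(-)"] refl bern_cong) blast
    finally have "?A = F n - B n" by (simp add: bern_def)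
    moreover have "cond_prob_Y n d (c / real n) (d_collapsible d) (in_F n d) = ?A / F n"
      by (simp add: cond_prob_Y_def prob_Y_def bern_def F_def)
    ultimately show ?case using elim \<delta> by (simp add: field_simps)
  qed
  ultimately show ?thesis using Lim_transform_eventually by fastforce
qed

end
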